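(* Let $S$ be a countable set and, for each $s\in S$, let $(X_s,d_s)$ be a Polish (complete separable metric) space, with $\sup_{s\in S}\operatorname{diam}(X_s)<\infty$. Let $X=\prod_{s\in S}X_s$ with the product topology and let $\mathcal{P}$ be the set of Borel probabilities on $X$. Then the Dobrushin distance $D$ and the Steif distance $\bar d$ on $\mathcal{P}$ are equal: for all $\mu,\nu\in\mathcal{P}$, $$D(\mu,\nu)=\bar d(\mu,\nu),$$ that is, $$\sup_{f\in\mathcal{F}\setminus\mathcal{C}}\frac{\mu(f)-\nu(f)}{\|f\|}=\inf_{m\in M}\ \sup_{s\in S} m(d_s),$$ where $\mathcal{F}$ is the set of Dobrushin smooth functions on $X$, $\mathcal{C}$ is the set of constant functions on $X$, $\|\cdot\|$ is the Dobrushin semi-norm, and $M$ is the set of joinings of $\mu$ to $\nu$.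
   Context: For $\mu\in\mathcal{P}$ (or a signed Borel measure) and measurable $f:X\to\mathbb{R}$, $\mu(f)$ denotes the integral of $f$ with respect to $\mu$; the same notation is used for measures on $X\times X$. For $x\in X$, $x_s$ denotes the component of $x$ in $X_s$. Each metric $d_s:X_s\times X_s\to\mathbb{R}$ is extended to a semi-metric on $X$, denoted by the same symbol, by $d_s(x,y)=d_s(x_s,y_s)$ for $x,y\in X$. For $f:X\to\mathbb{R}$ and $s\in S$, the partial Lipschitz constant is $$\Delta_s(f)=\sup\frac{f(x)-f(y)}{d_s(x,y)},$$ the supremum being over pairs $x\neq y\in X$ agreeing off $s$ (i.e. $x_t=y_t$ for all $t\neq s$). The Dobrushin semi-norm is $\|f\|=\sum_{s\in S}\Delta_s(f)\in\mathbb{R}_+\cup\{\infty\}$. The set $\mathcal{F}$ of Dobrushin smooth functions is the set of $f:X\to\mathbb{R}$ with $\|f\|<\infty$; $\mathcal{C}$ is the set of constant functions $X\to\mathbb{R}$. The Dobrushin distance between $\mu,\nu\in\mathcal{P}$ is $$D(\mu,\nu)=\sup_{f\in\mathcal{F}\setminus\mathcal{C}}\frac{\mu(f)-\nu(f)}{\|f\|}.$$ For $\mu,\nu\in\mathcal{P}$, $M$ is the set of joinings (couplings) of $\mu$ to $\nu$, i.e. the set of Borel probabilities $m$ on $X\times X$ whose marginals on the first and second factors are $\mu$ and $\nu$ respectively. The Steif distance between $\mu$ and $\nu$ is $$\bar d(\mu,\nu)=\inf_{m\in M}\ \sup_{s\in S} m(d_s).$$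
   Formalization: Dobrushin smooth functions are taken to be the continuous f with ‖f‖ < ∞; for infinite S the claim fails without continuity, since nonconstant Borel tail functions have ‖f‖ = 0 and can make D infinite, while for finite S continuity is automatic. *)

theory Defs
  imports "HOL-Probability.Probability"
begin

(* A family (X_s, d_s), s \<in> S, of metric spaces is rendered as X :: 'i \<Rightarrow> 'a metric together
   with an index set S. Using one ambient type 'a is no restriction, since the carriers
   mspace (X s) are arbitrary subsets of it and need not be related to each other.

   The suprema of the theory are taken in [0, \<infinity>] (type ennreal), so an empty supremum is 0.
   The coercion ennreal sends negative reals to 0; in "partial_lipschitz" and "dobrushin_dist"
   this changes nothing, because exchanging x and y, resp. replacing f by -f, changes the
   sign of the quotient. *)

definition metric_diam :: "'a metric \<Rightarrow> ennreal"
  where "metric_diam m = (SUP x\<in>mspace m. SUP y\<in>mspace m. ennreal (mdist m x y))"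

definition borel_of :: "'a topology \<Rightarrow> 'a measure"
  where "borel_of T = sigma (topspace T) {U. openin T U}"

definition borel_probs :: "'a topology \<Rightarrow> 'a measure set"
  where "borel_probs T = {\<mu>. prob_space \<mu> \<and> sets \<mu> = sets (borel_of T)}"

definition prod_space :: "'i set \<Rightarrow> ('i \<Rightarrow> 'a metric) \<Rightarrow> ('i \<Rightarrow> 'a) topology"
  where "prod_space S X = product_topology (\<lambda>s. mtopology_of (X s)) S"

definition partial_lipschitz ::
    "'i set \<Rightarrow> ('i \<Rightarrow> 'a metric) \<Rightarrow> (('i \<Rightarrow> 'a) \<Rightarrow> real) \<Rightarrow> 'i \<Rightarrow> ennreal"
  where "partial_lipschitz S X f s =
    (SUP (x, y) \<in> {(x, y). x \<in> topspace (prod_space S X) \<and> y \<in> topspace (prod_space S X) \<and>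
                           x \<noteq> y \<and> (\<forall>t\<in>S - {s}. x t = y t)}.
       ennreal ((f x - f y) / mdist (X s) (x s) (y s)))"

definition dobrushin_norm ::
    "'i set \<Rightarrow> ('i \<Rightarrow> 'a metric) \<Rightarrow> (('i \<Rightarrow> 'a) \<Rightarrow> real) \<Rightarrow> ennreal"
  where "dobrushin_norm S X f = (\<Sum>\<^sub>\<infinity>s\<in>S. partial_lipschitz S X f s)"

(* Dobrushin smooth functions are continuous by definition here. If S is finite, a finite norm
   already implies continuity. If S is infinite it does not even give measurability, and
   nonconstant bounded Borel functions of the tail have norm 0, so that without continuity the
   norm would not vanish on constants only and the Dobrushin distance could be infinite. *)
definition dobrushin_smooth :: "'i set \<Rightarrow> ('i \<Rightarrow> 'a metric) \<Rightarrow> (('i \<Rightarrow> 'a) \<Rightarrow> real) set"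
  where "dobrushin_smooth S X =
    {f. continuous_map (prod_space S X) euclideanreal f \<and> dobrushin_norm S X f < \<infinity>}"

definition constants :: "'i set \<Rightarrow> ('i \<Rightarrow> 'a metric) \<Rightarrow> (('i \<Rightarrow> 'a) \<Rightarrow> real) set"
  where "constants S X = {f. f constant_on topspace (prod_space S X)}"

definition dobrushin_dist ::
    "'i set \<Rightarrow> ('i \<Rightarrow> 'a metric) \<Rightarrow> ('i \<Rightarrow> 'a) measure \<Rightarrow> ('i \<Rightarrow> 'a) measure \<Rightarrow> ennreal"
  where "dobrushin_dist S X \<mu> \<nu> =
    (SUP f \<in> dobrushin_smooth S X - constants S X.
       ennreal ((\<integral>x. f x \<partial>\<mu>) - (\<integral>x. f x \<partial>\<nu>)) / dobrushin_norm S X f)"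

definition joinings :: "'a topology \<Rightarrow> 'a measure \<Rightarrow> 'a measure \<Rightarrow> ('a \<times> 'a) measure set"
  where "joinings T \<mu> \<nu> =
    {m \<in> borel_probs (prod_topology T T).
       distr m (borel_of T) fst = \<mu> \<and> distr m (borel_of T) snd = \<nu>}"

definition steif_dist ::
    "'i set \<Rightarrow> ('i \<Rightarrow> 'a metric) \<Rightarrow> ('i \<Rightarrow> 'a) measure \<Rightarrow> ('i \<Rightarrow> 'a) measure \<Rightarrow> ennreal"
  where "steif_dist S X \<mu> \<nu> =
    (INF m \<in> joinings (prod_space S X) \<mu> \<nu>.
       SUP s\<in>S. \<integral>\<^sup>+ (x, y). ennreal (mdist (X s) (x s) (y s)) \<partial>m)"

end

(*
  "D \<le> d": integrate f x - f y \<le> (\<Sum>s. Lip_s f * d_s x y) against a joining.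

  "d \<le> D": by the Kantorovich-Rubinstein inf-convolution, the conditions "marginals \<mu> and \<nu>,
  integral of each d_s at most D" on a positive functional on the bounded functions on X \<times> X are
  consistent, so Hahn-Banach provides such a functional. It restricts to a finitely additive
  joining, defined on all subsets. Since \<mu> and \<nu> are tight, the joining is countably additive on an
  algebra containing the open rectangles, and its Caratheodory extension is below the functional on
  open sets, hence on nonnegative continuous functions such as d_s. This requires neither
  minimax theorems nor weak compactness of the set of joinings, and treats all coordinates at once.
*)
theory Submission
  imports Defs
begin

subsection \<open>Borel sets and tightness in Polish spaces\<close>

text \<open>The sum over coordinates in \<open>dobrushin_norm\<close> is dual to the supremum over
  coordinates in \<open>steif_dist\<close>. Consistency of the conditions means that whenever u(x) +
  v(y) + \<Sum> w_s d_s(x,y) is nonnegative, with finitely many weights w_s \<ge> 0, so is its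
  prescribed value \<mu>(u) + \<nu>(v) + D \<Sum> w_s. The cost \<Sum> w_s d_s is a pseudometric, so
  the inf-convolution is a function f between -u and v whose partial Lipschitz constants are at most
  the w_s; the definition of the Dobrushin distance then gives \<mu>(f) - \<nu>(f) \<le> D \<Sum>
  w_s. The functional lives on all bounded functions, so that indicators of arbitrary sets lie in
  its domain. The obstacle is that it may fail to be countably additive: only its marginals are
  known to be measures, and these control rectangles. A general open set is exhausted by finite
  unions of rectangles, which yields an inequality instead of an equality. Its direction is the
  useful one: the extension can only lose mass on open sets, so the upper bounds for d_s survive,
  while the marginals are tested on rectangles U \<times> X and stay exact.\<close>

lemma space_borel_of [simp]: "space (borel_of T) = topspace T"
  by (auto simp: borel_of_def intro!: space_measure_of dest: openin_subset)

lemma sets_borel_of: "sets (borel_of T) = sigma_sets (topspace T) {U. openin T U}"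
  unfolding borel_of_def by (rule sets_measure_of) (auto dest: openin_subset)

lemma openin_borel_of: "openin T U \<Longrightarrow> U \<in> sets (borel_of T)"
  by (simp add: sets_borel_of sigma_sets.Basic)

lemma closedin_borel_of: "closedin T C \<Longrightarrow> C \<in> sets (borel_of T)"
proof -
  assume C: "closedin T C"
  then have "topspace T - (topspace T - C) \<in> sets (borel_of T)"
    using openin_borel_of[of T "topspace T - C"] sets.compl_sets[of "topspace T - C" "borel_of T"]
    by auto
  then show ?thesis using closedin_subset[OF C] by (simp add: double_diff)
qed

lemma continuous_map_measurable_borel_of:
  assumes "continuous_map T T' f"
  shows "f \<in> measurable (borel_of T) (borel_of T')"
  unfolding borel_of_def[of T']
proof (rule measurable_measure_of)
  show "f \<in> space (borel_of T) \<rightarrow> topspace T'"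
    using assms by (simp add: continuous_map_def)
  fix U assume "U \<in> {U. openin T' U}"
  then show "f -` U \<inter> space (borel_of T) \<in> sets (borel_of T)"
    using openin_continuous_map_preimage[OF assms, of U]
    by (auto intro!: openin_borel_of simp: vimage_def Int_def conj_commute)
qed (auto dest: openin_subset)

lemma continuous_map_borel_measurable:
  assumes "continuous_map T euclideanreal f"
  shows "f \<in> borel_measurable (borel_of T)"
  using continuous_map_measurable_borel_of[OF assms]
  by (simp add: borel_of_def borel_def)

section \<open>Countable bases of separable metric spaces and of countable products\<close>

lemma second_countable_metric:
  assumes "separable_space (mtopology_of m)"
  shows "second_countable (mtopology_of m)"
proof -
  interpret Metric_space "mspace m" "mdist m" by simp
  obtain C where C: "countable C" "C \<subseteq> topspace (mtopology_of m)"
    "mtopology_of m closure_of C = topspace (mtopology_of m)"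
    using assms by (auto simp: separable_space_def)
  define B where "B = (\<lambda>(c, n::nat). mball c (inverse (Suc n))) ` (C \<times> UNIV)"
  have "\<exists>V\<in>B. x \<in> V \<and> V \<subseteq> U" if U: "openin (mtopology_of m) U" "x \<in> U" for U x
  proof -
    from U obtain r where r: "r > 0" "mball x r \<subseteq> U"
      using openin_mtopology by (auto simp: mtopology_of_def)
    have x: "x \<in> mspace m" using U openin_subset[OF U(1)] by auto
    \<comment> \<open>With radius below r/2, a ball about c that contains x stays within distance r
      of x, so balls with centres in C and radii 1/(n+1) suffice.\<close>
    obtain n where n: "inverse (real (Suc n)) < r / 2"
      using reals_Archimedean[of "r/2"] r by auto
    have "x \<in> mtopology_of m closure_of C" using C x by simp
    moreover have "x \<in> mball x (inverse (Suc n))" using x by simp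
    ultimately obtain c where c: "c \<in> C" "c \<in> mball x (inverse (Suc n))"
      using openin_mball[of x "inverse (Suc n)"] unfolding closure_of_def mtopology_of_def by blast
    have "mball c (inverse (Suc n)) \<subseteq> mball x r"
    proof
      fix y assume y: "y \<in> mball c (inverse (Suc n))"
      then have "mdist m x y \<le> mdist m x c + mdist m c y"
        using c triangle[of x c y] by auto
      then show "y \<in> mball x r" using y c n by auto
    qed
    moreover have "x \<in> mball c (inverse (Suc n))" using c by (auto simp: commute)
    moreover have "mball c (inverse (Suc n)) \<in> B" using c by (auto simp: B_def)
    ultimately show ?thesis using r by blast
  qed
  moreover have "countable B" using C by (auto simp: B_def)
  moreover have "\<forall>V\<in>B. openin (mtopology_of m) V" by (auto simp: B_def mtopology_of_def)
  ultimately show ?thesis unfolding second_countable_def by blast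
qed

text \<open>Cylinders restricting finitely many coordinates to basic open sets form a base, and a
  countable index set has only countably many finite subsets.\<close>

lemma second_countable_product_topology:
  assumes "countable I" "\<And>i. i \<in> I \<Longrightarrow> second_countable (X i)"
  shows "second_countable (product_topology X I)"
proof -
  have "\<exists>B. \<forall>i\<in>I. countable (B i) \<and> (\<forall>V \<in> B i. openin (X i) V) \<and>
             (\<forall>U x. openin (X i) U \<and> x \<in> U \<longrightarrow> (\<exists>V \<in> B i. x \<in> V \<and> V \<subseteq> U))"
    using assms(2) unfolding second_countable_def by metis
  then obtain B where B: "\<And>i. i \<in> I \<Longrightarrow> countable (B i)"
    "\<And>i V. i \<in> I \<Longrightarrow> V \<in> B i \<Longrightarrow> openin (X i) V"
    "\<And>i U x. i \<in> I \<Longrightarrow> openin (X i) U \<Longrightarrow> x \<in> U \<Longrightarrow> \<exists>V \<in> B i. x \<in> V \<and> V \<subseteq> U"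
    by metis
  define cyl where "cyl F V = (\<Pi>\<^sub>E i\<in>I. if i \<in> F then V i else topspace (X i))"
    for F and V :: "'a \<Rightarrow> 'b set"
  define BB where "BB = (\<Union>F\<in>{F. finite F \<and> F \<subseteq> I}. cyl F ` (\<Pi>\<^sub>E i\<in>F. B i))"
  have "countable {F. finite F \<and> F \<subseteq> I}"
    using countable_Collect_finite_subset[OF assms(1)] by (simp add: conj_commute)
  then have "countable BB"
    unfolding BB_def by (intro countable_UN countable_image countable_PiE) (use B(1) in auto)
  moreover have "\<forall>V\<in>BB. openin (product_topology X I) V"
  proof
    fix W assume "W \<in> BB"
    then obtain F V where F: "finite F" "F \<subseteq> I" "V \<in> (\<Pi>\<^sub>E i\<in>F. B i)" "W = cyl F V"
      by (auto simp: BB_def)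
    have "finite {i \<in> I. (if i \<in> F then V i else topspace (X i)) \<noteq> topspace (X i)}"
      by (rule finite_subset[OF _ F(1)]) auto
    moreover have "openin (X i) (if i \<in> F then V i else topspace (X i))" if "i \<in> I" for i
      using F B(2)[OF that] by (auto simp: PiE_iff)
    ultimately show "openin (product_topology X I) W"
      unfolding F cyl_def by (subst openin_PiE_gen) auto
  qed
  moreover have "\<exists>V\<in>BB. x \<in> V \<and> V \<subseteq> U" if U: "openin (product_topology X I) U" "x \<in> U" for U x
  proof -
    obtain W where W: "finite {i \<in> I. W i \<noteq> topspace (X i)}" "\<And>i. i \<in> I \<Longrightarrow> openin (X i) (W i)"
      "x \<in> Pi\<^sub>E I W" "Pi\<^sub>E I W \<subseteq> U"
      using U(1)[unfolded openin_product_topology_alt, rule_format, OF U(2)] by (elim exE conjE) auto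
    define F where "F = {i \<in> I. W i \<noteq> topspace (X i)}"
    have "\<forall>i\<in>F. \<exists>V\<in>B i. x i \<in> V \<and> V \<subseteq> W i"
      using B(3) W(2,3) by (auto simp: F_def PiE_iff)
    then obtain V where V: "\<forall>i\<in>F. V i \<in> B i \<and> x i \<in> V i \<and> V i \<subseteq> W i" by metis
    have "cyl F (restrict V F) \<in> BB" using W(1) V by (auto simp: BB_def F_def)
    moreover have "x \<in> cyl F (restrict V F)" using V W(3) by (auto simp: cyl_def PiE_iff F_def)
    moreover have "cyl F (restrict V F) \<subseteq> Pi\<^sub>E I W"
      unfolding cyl_def by (rule PiE_mono) (use V in \<open>simp add: F_def\<close>)
    ultimately show ?thesis using W(4) by (meson order_trans)
  qed
  ultimately show ?thesis unfolding second_countable_def by blast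
qed

text \<open>Ulam's tightness theorem, sharpened so that open and closed sets are handled at once.\<close>
lemma compact_inner_approx_open:
  assumes T: "completely_metrizable_space T" "second_countable T"
    and \<mu>: "\<mu> \<in> borel_probs T" and U: "openin T U" and e: "e > 0"
  obtains K L where "compactin T K" "K \<subseteq> U" "compactin T L" "L \<subseteq> topspace T - U"
    "measure \<mu> (topspace T - (K \<union> L)) < e"
proof -
  interpret prob_space \<mu> using \<mu> by (simp add: borel_probs_def)
  have sets: "sets \<mu> = sets (borel_of T)" using \<mu> by (simp add: borel_probs_def)
  have sp: "space \<mu> = topspace T" using sets_eq_imp_space_eq[OF sets] by simp
  note ms = openin_borel_of[of T, folded sets] closedin_borel_of[of T, folded sets]
  obtain M d where Md: "Metric_space M d" "Metric_space.mcomplete M d" "T = Metric_space.mtopology M d"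
    using T(1) unfolding completely_metrizable_space_def by blast
  interpret Metric_space M d by (rule Md)
  have top: "topspace T = M" by (simp add: Md)
  obtain C where C: "countable C" "C \<subseteq> M" "mtopology closure_of C = M"
    using second_countable_imp_separable_space[OF T(2)] unfolding separable_space_def top Md(3) by auto
  have ne: "M \<noteq> {}" using not_empty sp top by simp
  then have "C \<noteq> {}" using C by auto
  define z where "z = from_nat_into C"
  have z: "range z = C" unfolding z_def using range_from_nat_into[OF \<open>C \<noteq> {}\<close> C(1)] .
  have zM: "z n \<in> M" for n using z C by auto
  \<comment> \<open>For fixed k the closed sets \<open>Q k n\<close> increase with n to the whole
    space, the points \<open>z j\<close> being dense. The choice \<open>N k\<close> below leaves out
    less than e/4 * (1/2)^k; these errors add up to e/2.\<close>
  define Q where "Q k n = (\<Union>j\<le>n. mcball (z j) (inverse (Suc k)))" for k n :: nat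
  have clQ: "closedin T (Q k n)" for k n
    unfolding Q_def Md by (intro closedin_Union) auto
  have UQ: "(\<Union>n. Q k n) = M" for k
  proof
    show "(\<Union>n. Q k n) \<subseteq> M" by (auto simp: Q_def)
    show "M \<subseteq> (\<Union>n. Q k n)"
    proof
      fix x assume x: "x \<in> M"
      then have "x \<in> mtopology closure_of C" using C by simp
      moreover have "x \<in> mball x (inverse (Suc k))" using x by simp
      ultimately obtain c where "c \<in> C" "c \<in> mball x (inverse (Suc k))"
        using openin_mball[of x "inverse (Suc k)"] unfolding closure_of_def by blast
      moreover then obtain j where "c = z j" using z by auto
      ultimately show "x \<in> (\<Union>n. Q k n)" using x by (fastforce simp: Q_def commute)
    qed
  qed
  have "\<exists>n. prob (M - Q k n) < e / 4 * (1/2)^k" for k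
  proof -
    have "(\<lambda>n. prob (M - Q k n)) \<longlonglongrightarrow> prob (\<Inter>n. M - Q k n)"
    proof (rule finite_Lim_measure_decseq)
      show "range (\<lambda>n. M - Q k n) \<subseteq> events"
        using ms(2)[OF clQ] sets.compl_sets[of _ \<mu>] sp top by auto
      show "decseq (\<lambda>n. M - Q k n)" unfolding Q_def by (intro decseq_SucI) (auto simp: atMost_Suc)
    qed
    moreover have "(\<Inter>n. M - Q k n) = {}" using UQ[of k] by auto
    ultimately have "(\<lambda>n. prob (M - Q k n)) \<longlonglongrightarrow> 0" by (metis measure_empty)
    then have "eventually (\<lambda>n. prob (M - Q k n) < e / 4 * (1/2)^k) sequentially"
      by (rule order_tendstoD) (use e in auto)
    then show ?thesis by (auto simp: eventually_sequentially)
  qed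
  then obtain N where N: "\<And>k. prob (M - Q k (N k)) < e / 4 * (1/2)^k" by metis
  define K0 where "K0 = (\<Inter>k. Q k (N k))"
  have clK0: "closedin T K0" unfolding K0_def by (intro closedin_Inter) (use clQ in auto)
  have "mtotally_bounded K0"
    unfolding mtotally_bounded_def
  proof (intro allI impI)
    fix r :: real assume "r > 0"
    then obtain k where k: "inverse (real (Suc k)) < r / 2" using reals_Archimedean[of "r/2"] by auto
    \<comment> \<open>\<open>mtotally_bounded\<close> asks for centres inside \<open>K0\<close>.
      Each \<open>z j\<close> whose ball of radius r/2 meets \<open>K0\<close> is replaced by a
      point \<open>y j\<close> of \<open>K0\<close> in that ball, which doubles the radius.\<close>
    define J where "J = {j. j \<le> N k \<and> K0 \<inter> mball (z j) (r/2) \<noteq> {}}"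
    have "\<forall>j\<in>J. \<exists>y. y \<in> K0 \<inter> mball (z j) (r/2)" by (auto simp: J_def)
    then obtain y where y: "\<And>j. j \<in> J \<Longrightarrow> y j \<in> K0 \<inter> mball (z j) (r/2)" by metis
    have "K0 \<subseteq> (\<Union>x\<in>y ` J. mball x r)"
    proof
      fix x assume x: "x \<in> K0"
      then have "x \<in> Q k (N k)" by (auto simp: K0_def)
      then obtain j where j: "j \<le> N k" "x \<in> mcball (z j) (inverse (Suc k))" by (auto simp: Q_def)
      then have xj: "x \<in> mball (z j) (r/2)" using k by auto
      then have "j \<in> J" using x j by (auto simp: J_def)
      moreover have "x \<in> mball (y j) r"
        using y[OF \<open>j \<in> J\<close>] xj triangle[of "y j" "z j" x] by (auto simp: commute)
      ultimately show "x \<in> (\<Union>x\<in>y ` J. mball x r)" by blast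
    qed
    moreover have "finite J" by (simp add: J_def)
    ultimately show "\<exists>K. finite K \<and> K \<subseteq> K0 \<and> K0 \<subseteq> (\<Union>x\<in>K. mball x r)"
      using y by (intro exI[of _ "y ` J"]) blast
  qed
  then have cK0: "compactin T K0"
    using mtotally_bounded_eq_compact_closure_of[of K0] Md clK0 closure_of_closedin[OF clK0] by auto
  have "prob (M - K0) \<le> (\<Sum>k. prob (M - Q k (N k)))"
  proof -
    have "M - K0 = (\<Union>k. M - Q k (N k))" by (auto simp: K0_def)
    moreover have "range (\<lambda>k. M - Q k (N k)) \<subseteq> events"
      using ms(2)[OF clQ] sets.compl_sets[of _ \<mu>] sp top by auto
    moreover have "summable (\<lambda>k. prob (M - Q k (N k)))"
      by (rule summable_comparison_test'[of "\<lambda>k. e / 4 * (1/2)^k" 0])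
         (use N in \<open>auto intro!: summable_mult summable_geometric simp: less_imp_le\<close>)
    ultimately show ?thesis using finite_measure_subadditive_countably by metis
  qed
  also have "\<dots> \<le> (\<Sum>k. e / 4 * (1/2)^k)"
    by (rule suminf_le)
       (use N in \<open>auto intro!: summable_mult summable_geometric less_imp_le
          summable_comparison_test'[of "\<lambda>k. e / 4 * (1/2)^k" 0]\<close>)
  also have "\<dots> = e / 2" by (subst suminf_mult) (auto intro!: summable_geometric simp: suminf_geometric)
  finally have K0e: "prob (M - K0) \<le> e / 2" .
  \<comment> \<open>The complement of U is closed, so its intersection with \<open>K0\<close> is
    already compact. U is F_sigma and is replaced by a closed \<open>F n\<close> inside it. The
    points missed lie outside \<open>K0\<close> or in \<open>U - F n\<close>, which accounts for the
    two halves of e.\<close>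
  have "closedin T (topspace T - U)" using U by auto
  have met: "metrizable_space T" using T(1) completely_metrizable_imp_metrizable_space by blast
  have "gdelta_in T (topspace T - U)" by (rule closed_imp_gdelta_in[OF met]) fact
  then have "fsigma_in T U"
    using openin_subset[OF U] by (simp add: fsigma_in_gdelta_in)
  then obtain F where F: "\<And>n. closedin T (F n)" "\<And>n. F n \<subseteq> F (Suc n)" "(\<Union>n. F n) = U"
    unfolding fsigma_in_ascending by metis
  have "(\<lambda>n. prob (U - F n)) \<longlonglongrightarrow> prob (\<Inter>n. U - F n)"
  proof (rule finite_Lim_measure_decseq)
    show "range (\<lambda>n. U - F n) \<subseteq> events" using ms(1)[OF U] ms(2)[OF F(1)] by auto
    show "decseq (\<lambda>n. U - F n)" using F(2) by (intro decseq_SucI) blast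
  qed
  moreover have "(\<Inter>n. U - F n) = {}" using F(3) by auto
  ultimately have "(\<lambda>n. prob (U - F n)) \<longlonglongrightarrow> 0" by (metis measure_empty)
  then have "eventually (\<lambda>n. prob (U - F n) < e / 2) sequentially"
    by (rule order_tendstoD) (use e in auto)
  then obtain n where n: "prob (U - F n) < e / 2" by (auto simp: eventually_sequentially)
  have FU: "F n \<subseteq> U" using F(3) by auto
  show ?thesis
  proof
    show "compactin T (F n \<inter> K0)" by (intro closed_Int_compactin F cK0)
    show "compactin T ((topspace T - U) \<inter> K0)" by (intro closed_Int_compactin cK0) fact
    have "measure \<mu> (topspace T - (F n \<inter> K0 \<union> (topspace T - U) \<inter> K0)) \<le> prob ((M - K0) \<union> (U - F n))"
      by (rule finite_measure_mono)
         (use ms(1)[OF U] ms(2)[OF F(1)] ms(2)[OF clK0] sets.compl_sets[of K0 \<mu>] sp top in auto)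
    also have "\<dots> \<le> prob (M - K0) + prob (U - F n)"
      by (rule measure_Un_le)
         (use ms(1)[OF U] ms(2)[OF F(1)] ms(2)[OF clK0] sets.compl_sets[of K0 \<mu>] sp top in auto)
    also have "\<dots> < e" using K0e n by simp
    finally show "measure \<mu> (topspace T - (F n \<inter> K0 \<union> (topspace T - U) \<inter> K0)) < e" .
  qed (use FU in auto)
qed

subsection \<open>Positive functionals on bounded functions\<close>

definition bounded_funs :: "'b set \<Rightarrow> ('b \<Rightarrow> real) set"
  where "bounded_funs \<Omega> = {f. \<exists>C. \<forall>z\<in>\<Omega>. \<bar>f z\<bar> \<le> C}"

definition linear_on_funs :: "('b \<Rightarrow> real) set \<Rightarrow> (('b \<Rightarrow> real) \<Rightarrow> real) \<Rightarrow> bool"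
  where "linear_on_funs V L \<longleftrightarrow>
    (\<forall>f\<in>V. \<forall>g\<in>V. L (\<lambda>z. f z + g z) = L f + L g) \<and> (\<forall>f\<in>V. \<forall>c. L (\<lambda>z. c * f z) = c * L f)"

text \<open>Homogeneity is stated as an inequality for t > 0 because infima satisfy this form by a
  direct check; equality, also at t = 0, is derived from it.\<close>

definition sublinear_on_funs :: "('b \<Rightarrow> real) set \<Rightarrow> (('b \<Rightarrow> real) \<Rightarrow> real) \<Rightarrow> bool"
  where "sublinear_on_funs V p \<longleftrightarrow>
    (\<forall>f\<in>V. \<forall>g\<in>V. p (\<lambda>z. f z + g z) \<le> p f + p g) \<and> (\<forall>f\<in>V. \<forall>t>0. p (\<lambda>z. t * f z) \<le> t * p f)"

lemma sublinear_on_funs_scale: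
  assumes p: "sublinear_on_funs V p" and V: "\<And>f c. f \<in> V \<Longrightarrow> (\<lambda>z. c * f z) \<in> V"
    and f: "f \<in> V" and t: "0 \<le> t"
  shows "p (\<lambda>z. t * f z) = t * p f"
proof -
  have le: "p (\<lambda>z. s * g z) \<le> s * p g" if "g \<in> V" "s > 0" for g s
    using p that by (auto simp: sublinear_on_funs_def)
  show ?thesis
  proof (cases "t = 0")
    case True
    \<comment> \<open>The factors 2 and 1/2 leave the zero function unchanged and give p 0 \<ge> 0
      and p 0 \<le> 0 respectively.\<close>
    have "p (\<lambda>z. 2 * (0 * f z)) \<le> 2 * p (\<lambda>z. 0 * f z)" "p (\<lambda>z. 1/2 * (0 * f z)) \<le> 1/2 * p (\<lambda>z. 0 * f z)"
      by (intro le V f; simp)+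
    then show ?thesis using True by simp
  next
    case False
    then have t: "t > 0" using t by simp
    have "p (\<lambda>z. inverse t * (t * f z)) \<le> inverse t * p (\<lambda>z. t * f z)"
      by (intro le V f) (use t in auto)
    then have "p f \<le> inverse t * p (\<lambda>z. t * f z)" using t by (simp flip: mult.assoc)
    then have "t * p f \<le> p (\<lambda>z. t * f z)" using t by (simp add: field_simps)
    with le[OF f t] show ?thesis by simp
  qed
qed

text \<open>From 0 = p (f - f). It bounds from below all sublinear functionals under a given one, so
  that infima over chains are finite.\<close>

lemma sublinear_on_funs_minus:
  assumes p: "sublinear_on_funs V p" and V: "\<And>f c. f \<in> V \<Longrightarrow> (\<lambda>z. c * f z) \<in> V" and f: "f \<in> V"
  shows "- p (\<lambda>z. (-1) * f z) \<le> p f"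
proof -
  have "p (\<lambda>z. f z + (-1) * f z) \<le> p f + p (\<lambda>z. (-1) * f z)"
    by (rule p[unfolded sublinear_on_funs_def, THEN conjunct1, rule_format, OF f V[OF f, of "-1"]])
  moreover have "p (\<lambda>z. f z + (-1) * f z) = 0"
    using sublinear_on_funs_scale[OF p _ f, of 0] V by simp
  ultimately show ?thesis by simp
qed

text \<open>Sublinearity leaves only superadditivity open, which minimality supplies; negative
  scalars then follow by adding c f and -c f. This replaces the one-dimensional extension step in
  the usual proof of Hahn-Banach.\<close>

lemma minimal_sublinear_linear:
  assumes q: "sublinear_on_funs V q" and V0: "V \<noteq> {}"
    and Va: "\<And>f g. f \<in> V \<Longrightarrow> g \<in> V \<Longrightarrow> (\<lambda>z. f z + g z) \<in> V"
    and V: "\<And>f c. f \<in> V \<Longrightarrow> (\<lambda>z. c * f z) \<in> V"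
    and min: "\<And>q' f. sublinear_on_funs V q' \<Longrightarrow> (\<And>f. f \<in> V \<Longrightarrow> q' f \<le> q f) \<Longrightarrow> f \<in> V \<Longrightarrow> q' f = q f"
  shows "linear_on_funs V q"
proof -
  have sub: "q (\<lambda>z. f z + g z) \<le> q f + q g" if "f \<in> V" "g \<in> V" for f g
    using q that by (auto simp: sublinear_on_funs_def)
  have sc: "q (\<lambda>z. t * f z) = t * q f" if "f \<in> V" "0 \<le> t" for f t
    by (rule sublinear_on_funs_scale[OF q _ that]) (rule V)
  have add: "q (\<lambda>z. f z + h z) = q f + q h" if f: "f \<in> V" and h: "h \<in> V" for f h
  proof (rule antisym)
    \<comment> \<open>\<open>q'\<close> is a sublinear functional below \<open>q\<close>, so \<open>q' = q\<close>; take \<open>t = 1\<close> in the infimum.\<close>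
    define q' where "q' g = (INF t\<in>{0..}. q (\<lambda>z. g z + t * h z) - t * q h)" for g
    have lower: "- q (\<lambda>z. (-1) * g z) \<le> q (\<lambda>z. g z + t * h z) - t * q h" if "g \<in> V" "t \<ge> 0" for g t
    proof -
      have "q (\<lambda>z. (g z + t * h z) + (-1) * g z) \<le> q (\<lambda>z. g z + t * h z) + q (\<lambda>z. (-1) * g z)"
        by (intro sub Va V that h)
      then show ?thesis using sc[OF h that(2)] by simp
    qed
    have bdd: "bdd_below ((\<lambda>t. q (\<lambda>z. g z + t * h z) - t * q h) ` {0..})" if "g \<in> V" for g
      using lower[OF that] by (intro bdd_belowI2[of _ "- q (\<lambda>z. (-1) * g z)"]) auto
    have le: "q' g \<le> q (\<lambda>z. g z + t * h z) - t * q h" if "g \<in> V" "t \<ge> 0" for g t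
      unfolding q'_def by (rule cINF_lower[OF bdd]) (use that in auto)
    have ge: "c \<le> q' g" if "\<And>t. t \<ge> 0 \<Longrightarrow> c \<le> q (\<lambda>z. g z + t * h z) - t * q h" for g c
      unfolding q'_def by (rule cINF_greatest) (use that in auto)
    have "sublinear_on_funs V q'"
      unfolding sublinear_on_funs_def
    proof (intro conjI ballI allI impI)
      fix g1 g2 assume g: "g1 \<in> V" "g2 \<in> V"
      \<comment> \<open>The parameters t1 for g1 and t2 for g2 combine to t1 + t2 for the sum. The
        two infima are taken one after the other, with the other term moved across the
        inequality.\<close>
      have "q' (\<lambda>z. g1 z + g2 z) - (q (\<lambda>z. g2 z + t2 * h z) - t2 * q h) \<le> q' g1" if t2: "t2 \<ge> 0" for t2
      proof (rule ge)
        fix t1 :: real assume t1: "t1 \<ge> 0"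
        have "q' (\<lambda>z. g1 z + g2 z) \<le> q (\<lambda>z. (g1 z + g2 z) + (t1 + t2) * h z) - (t1 + t2) * q h"
          by (intro le Va g) (use t1 t2 in auto)
        also have "(\<lambda>z. (g1 z + g2 z) + (t1 + t2) * h z) = (\<lambda>z. (g1 z + t1 * h z) + (g2 z + t2 * h z))"
          by (auto simp: algebra_simps)
        also have "q \<dots> \<le> q (\<lambda>z. g1 z + t1 * h z) + q (\<lambda>z. g2 z + t2 * h z)"
          by (intro sub Va V g h)
        finally show "q' (\<lambda>z. g1 z + g2 z) - (q (\<lambda>z. g2 z + t2 * h z) - t2 * q h) \<le>
          q (\<lambda>z. g1 z + t1 * h z) - t1 * q h" by (simp add: algebra_simps)
      qed
      then have "q' (\<lambda>z. g1 z + g2 z) - q' g1 \<le> q' g2" by (intro ge) (smt (verit))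
      then show "q' (\<lambda>z. g1 z + g2 z) \<le> q' g1 + q' g2" by simp
    next
      fix g and s :: real assume g: "g \<in> V" and s: "s > 0"
      have "q' (\<lambda>z. s * g z) / s \<le> q' g"
      proof (rule ge)
        fix t :: real assume t: "t \<ge> 0"
        have "q' (\<lambda>z. s * g z) \<le> q (\<lambda>z. s * g z + (s * t) * h z) - (s * t) * q h"
          by (intro le V g) (use s t in auto)
        also have "(\<lambda>z. s * g z + (s * t) * h z) = (\<lambda>z. s * (g z + t * h z))"
          by (auto simp: algebra_simps)
        also have "q \<dots> = s * q (\<lambda>z. g z + t * h z)" by (intro sc Va V g h) (use s in auto)
        finally show "q' (\<lambda>z. s * g z) / s \<le> q (\<lambda>z. g z + t * h z) - t * q h"
          using s by (simp add: field_simps)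
      qed
      then show "q' (\<lambda>z. s * g z) \<le> s * q' g" using s by (simp add: field_simps)
    qed
    then have "q' f = q f" by (rule min) (use le[of _ 0] f in auto)
    with le[OF f, of 1] show "q f + q h \<le> q (\<lambda>z. f z + h z)" by simp
  qed (rule sub[OF f h])
  have zero: "q (\<lambda>z. 0) = 0" using V0 sc[of _ 0] by auto
  have "q (\<lambda>z. c * f z) = c * q f" if f: "f \<in> V" for f c
  proof (cases "c \<ge> 0")
    case False
    have "q (\<lambda>z. c * f z + (- c) * f z) = q (\<lambda>z. c * f z) + q (\<lambda>z. (- c) * f z)"
      by (intro add V f)
    then show ?thesis using sc[OF f, of "- c"] zero False by simp
  qed (simp add: sc f)
  with add show ?thesis by (auto simp: linear_on_funs_def)
qed

text \<open>Hahn-Banach without a prescribed subspace, since all constraints will be encoded in p: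
  Zorn's lemma yields a minimal sublinear functional below p, and minimality makes it
  linear.\<close>

lemma sublinear_dominates_linear:
  assumes p: "sublinear_on_funs V p" and V0: "V \<noteq> {}"
    and Va: "\<And>f g. f \<in> V \<Longrightarrow> g \<in> V \<Longrightarrow> (\<lambda>z. f z + g z) \<in> V"
    and V: "\<And>f c. f \<in> V \<Longrightarrow> (\<lambda>z. c * f z) \<in> V"
  obtains L where "linear_on_funs V L" "\<And>f. f \<in> V \<Longrightarrow> L f \<le> p f"
proof -
  \<comment> \<open>Values off V are pinned to 0; otherwise they could be lowered without end and no
    minimal element would exist.\<close>
  define A where "A = {q. sublinear_on_funs V q \<and> (\<forall>f\<in>V. q f \<le> p f) \<and> (\<forall>f. f \<notin> V \<longrightarrow> q f = 0)}"
  have lower: "- p (\<lambda>z. (-1) * f z) \<le> q f" if "q \<in> A" "f \<in> V" for q f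
    using sublinear_on_funs_minus[of V q f] that V[OF that(2), of "-1"] V by (force simp: A_def)
  have ext: "(\<lambda>f. if f \<in> V then q f else 0) \<in> A"
    if "sublinear_on_funs V q" "\<And>f. f \<in> V \<Longrightarrow> q f \<le> p f" for q
    using that Va V by (auto simp: A_def sublinear_on_funs_def)
  have "\<exists>m\<in>A. \<forall>a\<in>A. (\<forall>f. a f \<le> m f) \<longrightarrow> a = m"
  \<comment> \<open>The order is reversed, so that Zorn's maximal element is pointwise minimal; a
    chain is bounded by its pointwise infimum.\<close>
  proof (rule predicate_Zorn[where P = "\<lambda>q q'. \<forall>f. q' f \<le> q f", simplified])
    show "partial_order_on A (relation_of (\<lambda>q q'. \<forall>f. q' f \<le> q f) A)"
      by (rule partial_order_on_relation_ofI) (auto simp: fun_eq_iff intro: order_trans antisym)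
    fix C assume C: "C \<in> Chains (relation_of (\<lambda>q q'. \<forall>f. q' f \<le> q f) A)"
    then have CA: "C \<subseteq> A" by (auto simp: Chains_def relation_of_def)
    have tot: "(\<forall>f. a f \<le> b f) \<or> (\<forall>f. b f \<le> a f)" if "a \<in> C" "b \<in> C" for a b
      using C that by (auto simp: Chains_def relation_of_def)
    show "\<exists>u\<in>A. \<forall>a\<in>C. \<forall>f. u f \<le> a f"
    proof (cases "C = {}")
      case True
      then show ?thesis using ext[OF p] by auto
    next
      case False
      define u where "u f = (INF q\<in>C. q f)" for f
      have le: "u f \<le> q f" if "f \<in> V" "q \<in> C" for f q
        unfolding u_def using that lower CA
        by (intro cINF_lower bdd_belowI2[of _ "- p (\<lambda>z. (-1) * f z)"]) auto
      have ge: "c \<le> u f" if "\<And>q. q \<in> C \<Longrightarrow> c \<le> q f" for c f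
        unfolding u_def using False that by (rule cINF_greatest)
      have "sublinear_on_funs V u"
        unfolding sublinear_on_funs_def
      proof (intro conjI ballI allI impI)
        fix f g assume fg: "f \<in> V" "g \<in> V"
        have "u (\<lambda>z. f z + g z) \<le> q1 f + q2 g" if q12: "q1 \<in> C" "q2 \<in> C" for q1 q2
        proof -
          \<comment> \<open>Of two members of a chain, the smaller one serves f and g
            together.\<close>
          obtain q where q: "q \<in> C" "q f \<le> q1 f" "q g \<le> q2 g"
            using tot[OF q12] q12 by blast
          have "u (\<lambda>z. f z + g z) \<le> q (\<lambda>z. f z + g z)" by (intro le Va fg q)
          also have "\<dots> \<le> q f + q g" using q(1) CA fg by (auto simp: A_def sublinear_on_funs_def)
          finally show ?thesis using q by simp
        qed
        then have "u (\<lambda>z. f z + g z) - q2 g \<le> u f" if "q2 \<in> C" for q2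
          using that by (intro ge) (smt (verit))
        then have "u (\<lambda>z. f z + g z) - u f \<le> u g" by (intro ge) (smt (verit))
        then show "u (\<lambda>z. f z + g z) \<le> u f + u g" by simp
      next
        fix f and t :: real assume f: "f \<in> V" and t: "t > 0"
        have "u (\<lambda>z. t * f z) / t \<le> u f"
        proof (rule ge)
          fix q assume q: "q \<in> C"
          have "u (\<lambda>z. t * f z) \<le> q (\<lambda>z. t * f z)" by (intro le V f q)
          also have "\<dots> \<le> t * q f" using q CA f t by (auto simp: A_def sublinear_on_funs_def)
          finally show "u (\<lambda>z. t * f z) / t \<le> q f" using t by (simp add: field_simps)
        qed
        then show "u (\<lambda>z. t * f z) \<le> t * u f" using t by (simp add: field_simps)
      qed
      moreover have "u f \<le> p f" if "f \<in> V" for f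
        using False CA le[OF that] that by (fastforce simp: A_def)
      ultimately have "(\<lambda>f. if f \<in> V then u f else 0) \<in> A" by (rule ext)
      moreover have "\<forall>a\<in>C. \<forall>f. (if f \<in> V then u f else 0) \<le> a f"
        using le CA by (auto simp: A_def)
      ultimately show ?thesis by (intro bexI[of _ "\<lambda>f. if f \<in> V then u f else 0"])
    qed
  qed
  then obtain m where m: "m \<in> A" "\<And>a. a \<in> A \<Longrightarrow> (\<And>f. a f \<le> m f) \<Longrightarrow> a = m" by metis
  have "linear_on_funs V m"
  proof (rule minimal_sublinear_linear[OF _ V0 Va V])
    show "sublinear_on_funs V m" using m(1) by (simp add: A_def)
    fix q' f assume q': "sublinear_on_funs V q'" "\<And>f. f \<in> V \<Longrightarrow> q' f \<le> m f" and f: "f \<in> V"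
    have "q' f \<le> p f" if "f \<in> V" for f using q'(2)[OF that] m(1) that by (force simp: A_def)
    then have "(\<lambda>f. if f \<in> V then q' f else 0) = m"
      by (intro m(2) ext q') (use m(1) q'(2) in \<open>auto simp: A_def\<close>)
    then show "q' f = m f" using f by (auto dest: fun_cong[of _ _ f])
  qed
  moreover have "m f \<le> p f" if "f \<in> V" for f using m(1) that by (auto simp: A_def)
  ultimately show ?thesis by (rule that)
qed

section \<open>Positive functionals subject to a cone of upper bounds\<close>

lemma bounded_funs_add: "f \<in> bounded_funs \<Omega> \<Longrightarrow> g \<in> bounded_funs \<Omega> \<Longrightarrow> (\<lambda>z. f z + g z) \<in> bounded_funs \<Omega>"
  unfolding bounded_funs_def
proof clarify
  fix C D assume "\<forall>z\<in>\<Omega>. \<bar>f z\<bar> \<le> C" "\<forall>z\<in>\<Omega>. \<bar>g z\<bar> \<le> D"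
  then show "\<exists>C. \<forall>z\<in>\<Omega>. \<bar>f z + g z\<bar> \<le> C"
    by (intro exI[of _ "C + D"]) (meson abs_triangle_ineq add_mono order_trans)
qed

lemma bounded_funs_scale: "f \<in> bounded_funs \<Omega> \<Longrightarrow> (\<lambda>z. c * f z) \<in> bounded_funs \<Omega>"
  unfolding bounded_funs_def
proof clarify
  fix C assume "\<forall>z\<in>\<Omega>. \<bar>f z\<bar> \<le> C"
  then show "\<exists>C. \<forall>z\<in>\<Omega>. \<bar>c * f z\<bar> \<le> C"
    by (intro exI[of _ "\<bar>c\<bar> * C"]) (auto simp: abs_mult intro: mult_left_mono)
qed

lemma bounded_funsI: "(\<And>z. z \<in> \<Omega> \<Longrightarrow> \<bar>f z\<bar> \<le> C) \<Longrightarrow> f \<in> bounded_funs \<Omega>"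
  by (auto simp: bounded_funs_def)

text \<open>A pair (h, r) stands for the demand L h \<le> r. The functional \<open>p g\<close>, the
  least r over all h in the cone that dominate g, is the superhedging price of g: sublinear because
  P is a convex cone, and finite from below thanks to \<open>pos\<close>, the consistency of the
  demands. Positivity of L comes from the pair (0, 0), which dominates -f when f \<ge> 0.\<close>

lemma positive_functional_exists:
  fixes P :: "(('b \<Rightarrow> real) \<times> real) set"
  assumes add: "\<And>h r h' r'. (h, r) \<in> P \<Longrightarrow> (h', r') \<in> P \<Longrightarrow> (\<lambda>z. h z + h' z, r + r') \<in> P"
    and scale: "\<And>h r t. (h, r) \<in> P \<Longrightarrow> t > 0 \<Longrightarrow> (\<lambda>z. t * h z, t * r) \<in> P"
    and const: "\<And>c. (\<lambda>z. c, c) \<in> P"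
    and pos: "\<And>h r. (h, r) \<in> P \<Longrightarrow> (\<And>z. z \<in> \<Omega> \<Longrightarrow> 0 \<le> h z) \<Longrightarrow> 0 \<le> r"
  obtains L where "linear_on_funs (bounded_funs \<Omega>) L"
    "\<And>f. f \<in> bounded_funs \<Omega> \<Longrightarrow> (\<And>z. z \<in> \<Omega> \<Longrightarrow> 0 \<le> f z) \<Longrightarrow> 0 \<le> L f"
    "\<And>h r. (h, r) \<in> P \<Longrightarrow> h \<in> bounded_funs \<Omega> \<Longrightarrow> L h \<le> r"
proof -
  define R where "R g = {r. \<exists>h. (h, r) \<in> P \<and> (\<forall>z\<in>\<Omega>. g z \<le> h z)}" for g
  define p where "p g = Inf (R g)" for g
  have ne: "R g \<noteq> {}" if g: "g \<in> bounded_funs \<Omega>" for g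
  proof -
    obtain C where "\<forall>z\<in>\<Omega>. \<bar>g z\<bar> \<le> C" using g by (auto simp: bounded_funs_def)
    then have "C \<in> R g" unfolding R_def using const[of C] by (auto intro!: exI[of _ "\<lambda>z. C"])
    then show ?thesis by auto
  qed
  have bdd: "bdd_below (R g)" if g: "g \<in> bounded_funs \<Omega>" for g
  proof -
    obtain C where C: "\<forall>z\<in>\<Omega>. \<bar>g z\<bar> \<le> C" using g by (auto simp: bounded_funs_def)
    have "- C \<le> r" if "r \<in> R g" for r
    proof -
      obtain h where h: "(h, r) \<in> P" "\<forall>z\<in>\<Omega>. g z \<le> h z" using \<open>r \<in> R g\<close> by (auto simp: R_def)
      \<comment> \<open>The pair (h + C, r + C) belongs to P and its function is nonnegative on
        \<Omega>, as h \<ge> g \<ge> -C there.\<close>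
      have "0 \<le> r + C" by (rule pos[OF add[OF h(1) const]]) (use h(2) C in force)
      then show ?thesis by simp
    qed
    then show ?thesis by (rule bdd_belowI)
  qed
  have le: "p g \<le> r" if "g \<in> bounded_funs \<Omega>" "(h, r) \<in> P" "\<And>z. z \<in> \<Omega> \<Longrightarrow> g z \<le> h z" for g h r
    unfolding p_def by (rule cInf_lower[OF _ bdd]) (use that in \<open>auto simp: R_def\<close>)
  have ge: "c \<le> p g"
    if "g \<in> bounded_funs \<Omega>" "\<And>h r. (h, r) \<in> P \<Longrightarrow> (\<And>z. z \<in> \<Omega> \<Longrightarrow> g z \<le> h z) \<Longrightarrow> c \<le> r" for g c
    unfolding p_def by (rule cInf_greatest[OF ne]) (use that in \<open>auto simp: R_def\<close>)
  have "sublinear_on_funs (bounded_funs \<Omega>) p"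
    unfolding sublinear_on_funs_def
  proof (intro conjI ballI allI impI)
    fix f g assume f: "f \<in> bounded_funs \<Omega>" and g: "g \<in> bounded_funs \<Omega>"
    have "p (\<lambda>z. f z + g z) - p f \<le> p g"
    proof (rule ge[OF g])
      fix h' r' assume h': "(h', r') \<in> P" "\<And>z. z \<in> \<Omega> \<Longrightarrow> g z \<le> h' z"
      have "p (\<lambda>z. f z + g z) - r' \<le> p f"
      proof (rule ge[OF f])
        fix h r assume h: "(h, r) \<in> P" "\<And>z. z \<in> \<Omega> \<Longrightarrow> f z \<le> h z"
        have "p (\<lambda>z. f z + g z) \<le> r + r'"
          by (rule le[OF bounded_funs_add[OF f g] add[OF h(1) h'(1)]]) (intro add_mono h h')
        then show "p (\<lambda>z. f z + g z) - r' \<le> r" by simp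
      qed
      then show "p (\<lambda>z. f z + g z) - p f \<le> r'" by simp
    qed
    then show "p (\<lambda>z. f z + g z) \<le> p f + p g" by simp
  next
    fix f and t :: real assume f: "f \<in> bounded_funs \<Omega>" and t: "t > 0"
    have "p (\<lambda>z. t * f z) / t \<le> p f"
    proof (rule ge[OF f])
      fix h r assume h: "(h, r) \<in> P" "\<And>z. z \<in> \<Omega> \<Longrightarrow> f z \<le> h z"
      have "p (\<lambda>z. t * f z) \<le> t * r"
        by (rule le[OF bounded_funs_scale[OF f] scale[OF h(1) t]]) (use t h(2) in auto)
      then show "p (\<lambda>z. t * f z) / t \<le> r" using t by (simp add: field_simps)
    qed
    then show "p (\<lambda>z. t * f z) \<le> t * p f" using t by (simp add: field_simps)
  qed
  moreover have "(\<lambda>z. 0) \<in> bounded_funs \<Omega>" by (auto simp: bounded_funs_def)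
  then have "bounded_funs \<Omega> \<noteq> {}" by blast
  ultimately obtain L where L: "linear_on_funs (bounded_funs \<Omega>) L" "\<And>f. f \<in> bounded_funs \<Omega> \<Longrightarrow> L f \<le> p f"
    by (rule sublinear_dominates_linear) (assumption | rule bounded_funs_add bounded_funs_scale | blast)+
  show ?thesis
  proof
    fix f assume f: "f \<in> bounded_funs \<Omega>" "\<And>z. z \<in> \<Omega> \<Longrightarrow> 0 \<le> f z"
    have "L (\<lambda>z. (-1) * f z) \<le> p (\<lambda>z. (-1) * f z)" by (intro L bounded_funs_scale f)
    also have "\<dots> \<le> 0" by (rule le[OF bounded_funs_scale[OF f(1)] const]) (use f in auto)
    also have "L (\<lambda>z. (-1) * f z) = (-1) * L f" using L(1) f(1) unfolding linear_on_funs_def by blast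
    finally show "0 \<le> L f" by simp
  next
    fix h r assume "(h, r) \<in> P" "h \<in> bounded_funs \<Omega>"
    then show "L h \<le> r" using L(2) le by (meson order_refl order_trans)
  qed fact
qed

subsection \<open>From finitely additive to countably additive joinings\<close>

locale content =
  fixes T :: "'b topology" and m :: "'b set \<Rightarrow> real"
  assumes nonneg: "E \<subseteq> topspace T \<Longrightarrow> 0 \<le> m E"
    and add: "E \<subseteq> topspace T \<Longrightarrow> F \<subseteq> topspace T \<Longrightarrow> E \<inter> F = {} \<Longrightarrow> m (E \<union> F) = m E + m F"
begin

lemma empty: "m {} = 0"
  using add[of "{}" "{}"] by simp

lemma mono: "E \<subseteq> F \<Longrightarrow> F \<subseteq> topspace T \<Longrightarrow> m E \<le> m F"
proof -
  assume EF: "E \<subseteq> F" "F \<subseteq> topspace T"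
  then have "m (E \<union> (F - E)) = m E + m (F - E)" by (intro add) auto
  moreover have "E \<union> (F - E) = F" using EF by auto
  moreover have "0 \<le> m (F - E)" using EF by (intro nonneg) auto
  ultimately show "m E \<le> m F" by simp
qed

lemma subadd: "E \<subseteq> topspace T \<Longrightarrow> F \<subseteq> topspace T \<Longrightarrow> m (E \<union> F) \<le> m E + m F"
proof -
  assume EF: "E \<subseteq> topspace T" "F \<subseteq> topspace T"
  then have "m (E \<union> (F - E)) = m E + m (F - E)" by (intro add) auto
  moreover have "m (F - E) \<le> m F" by (intro mono) (use EF in auto)
  ultimately show ?thesis by simp
qed

lemma subadd_UN:
  assumes "finite I" "\<And>i. i \<in> I \<Longrightarrow> E i \<subseteq> topspace T"
  shows "m (\<Union>i\<in>I. E i) \<le> (\<Sum>i\<in>I. m (E i))"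
  using assms
proof (induction I rule: finite_induct)
  case (insert i I)
  have "m (E i \<union> (\<Union>i\<in>I. E i)) \<le> m (E i) + m (\<Union>i\<in>I. E i)"
    by (rule subadd) (use insert.prems in auto)
  then show ?case using insert by force
qed (simp add: empty)

end

locale tight_content = content T m for T :: "'b topology" and m +
  assumes Hausdorff: "Hausdorff_space T"
    and tight: "e > 0 \<Longrightarrow> \<exists>K. compactin T K \<and> m (topspace T - K) < e"
begin

text \<open>Approximating a set and its complement by compact sets simultaneously makes the family an
  algebra, so that inner regularity is needed only for the generating open rectangles.\<close>
definition approximable :: "'b set set"
  where "approximable = {E. E \<subseteq> topspace T \<and> (\<forall>e>0. \<exists>K L. compactin T K \<and> K \<subseteq> E \<and>
    compactin T L \<and> L \<subseteq> topspace T - E \<and> m (topspace T - (K \<union> L)) < e)}"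

lemma approximable_compl:
  assumes "E \<in> approximable" shows "topspace T - E \<in> approximable"
proof -
  have "topspace T - (topspace T - E) = E" using assms by (auto simp: approximable_def)
  then show ?thesis using assms unfolding approximable_def
    by (auto simp: Un_commute) (metis Un_commute)
qed

text \<open>The inner sets are united and the outer ones intersected. A point outside both results
  is missed by one of the two given pairs. Compactness of the intersection uses that compact sets
  are closed in a Hausdorff space.\<close>

lemma approximable_Un:
  assumes E: "E \<in> approximable" and F: "F \<in> approximable"
  shows "E \<union> F \<in> approximable"
  unfolding approximable_def
proof (intro CollectI conjI allI impI)
  show "E \<union> F \<subseteq> topspace T" using E F by (auto simp: approximable_def)
  fix e :: real assume "e > 0"
  then have e: "e / 2 > 0" by simp
  obtain K L where KL: "compactin T K" "K \<subseteq> E" "compactin T L" "L \<subseteq> topspace T - E"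
    "m (topspace T - (K \<union> L)) < e / 2" using E e unfolding approximable_def by blast
  obtain K' L' where KL': "compactin T K'" "K' \<subseteq> F" "compactin T L'" "L' \<subseteq> topspace T - F"
    "m (topspace T - (K' \<union> L')) < e / 2" using F e unfolding approximable_def by blast
  have "m (topspace T - ((K \<union> K') \<union> (L \<inter> L'))) \<le> m ((topspace T - (K \<union> L)) \<union> (topspace T - (K' \<union> L')))"
    by (rule mono) auto
  also have "\<dots> \<le> m (topspace T - (K \<union> L)) + m (topspace T - (K' \<union> L'))" by (rule subadd) auto
  also have "\<dots> < e" using KL(5) KL'(5) by simp
  finally have "m (topspace T - ((K \<union> K') \<union> (L \<inter> L'))) < e" .
  moreover have "compactin T (K \<union> K')" by (intro compactin_Un KL KL')
  moreover have "compactin T (L \<inter> L')"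
    by (intro closed_Int_compactin compactin_imp_closedin Hausdorff KL KL')
  moreover have "K \<union> K' \<subseteq> E \<union> F" "L \<inter> L' \<subseteq> topspace T - (E \<union> F)" using KL KL' by auto
  ultimately show "\<exists>K L. compactin T K \<and> K \<subseteq> E \<union> F \<and>
    compactin T L \<and> L \<subseteq> topspace T - (E \<union> F) \<and> m (topspace T - (K \<union> L)) < e" by blast
qed

lemma approximable_algebra: "algebra (topspace T) approximable"
proof -
  \<comment> \<open>For the empty set K is empty, and L is the large compact set that tightness
    provides.\<close>
  have "{} \<in> approximable"
    using tight by (fastforce simp: approximable_def dest: compactin_subset_topspace)
  then show ?thesis
    by (auto simp: algebra_iff_Un approximable_compl approximable_Un) (auto simp: approximable_def)
qed

text \<open>The compact class argument: if the values stayed above some e > 0, compact subsets of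
  the \<open>A i\<close> with small total loss would have nonempty finite intersections, hence a
  common point, which would lie in every \<open>A i\<close>.\<close>

lemma approximable_inter_empty:
  assumes A: "range A \<subseteq> approximable" "decseq A" "(\<Inter>i. A i) = {}"
  shows "(\<lambda>i. m (A i)) \<longlonglongrightarrow> 0"
proof -
  have sub: "A i \<subseteq> topspace T" for i using A(1) by (auto simp: approximable_def)
  have "\<exists>n. m (A n) < e" if e: "e > 0" for e
  proof (rule ccontr)
    assume "\<nexists>n. m (A n) < e"
    then have large: "e \<le> m (A n)" for n by (meson not_le)
    \<comment> \<open>The losses e/4 * (1/2)^i sum to less than e, so they cannot exhaust a set of
      content at least e.\<close>
    have "\<exists>K. compactin T K \<and> K \<subseteq> A i \<and> m (A i - K) < e / 4 * (1/2)^i" for i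
    proof -
      have "e / 4 * (1/2)^i > 0" using e by simp
      moreover have "A i \<in> approximable" using A(1) by auto
      ultimately obtain K L where KL: "compactin T K" "K \<subseteq> A i" "compactin T L" "L \<subseteq> topspace T - A i"
        "m (topspace T - (K \<union> L)) < e / 4 * (1/2)^i" unfolding approximable_def by blast
      have "m (A i - K) \<le> m (topspace T - (K \<union> L))" by (rule mono) (use KL sub in auto)
      then show ?thesis using KL by force
    qed
    then obtain K where K: "\<And>i. compactin T (K i)" "\<And>i. K i \<subseteq> A i"
      "\<And>i. m (A i - K i) < e / 4 * (1/2)^i" by metis
    define C where "C n = (\<Inter>i\<le>n. K i)" for n
    have clK: "closedin T (K i)" for i by (intro compactin_imp_closedin Hausdorff K)
    have "C n \<noteq> {}" for n
    proof
      assume Cn: "C n = {}"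
      have "A n \<subseteq> (\<Union>i\<le>n. A i - K i)"
      proof
        fix x assume x: "x \<in> A n"
        obtain i where i: "i \<le> n" "x \<notin> K i" using Cn unfolding C_def by blast
        then have "x \<in> A i - K i" using decseqD[OF A(2) i(1)] x by blast
        with i show "x \<in> (\<Union>i\<le>n. A i - K i)" by blast
      qed
      then have "m (A n) \<le> m (\<Union>i\<le>n. A i - K i)" by (rule mono) (use sub in auto)
      also have "\<dots> \<le> (\<Sum>i\<le>n. m (A i - K i))" by (rule subadd_UN) (use sub in auto)
      also have "\<dots> \<le> (\<Sum>i\<le>n. e / 4 * (1/2)^i)" by (intro sum_mono less_imp_le K)
      also have "\<dots> = e / 4 * (\<Sum>i\<le>n. (1/2)^i)" by (simp add: sum_distrib_left)
      also have "(\<Sum>i\<le>n. (1/2::real)^i) = 2 - (1/2)^n" by (induction n) (auto simp: field_simps)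
      also have "e / 4 * (2 - (1/2)^n) < e" using e by (simp add: field_simps add_pos_pos)
      finally show False using large[of n] by simp
    qed
    moreover have "closedin (subtopology T (K 0)) (C n)" for n
    proof (rule closedin_subset_topspace)
      show "closedin T (C n)" unfolding C_def by (intro closedin_Inter) (use clK in auto)
      show "C n \<subseteq> K 0" by (auto simp: C_def)
    qed
    moreover have "decseq C" unfolding C_def by (intro decseq_SucI) (auto simp: atMost_Suc)
    moreover have "compact_space (subtopology T (K 0))" using K(1) by (simp add: compact_space_subtopology)
    ultimately have "(\<Inter>n. C n) \<noteq> {}" by (intro compact_space_imp_nest)
    moreover have CA: "C n \<subseteq> A n" for n using K(2)[of n] by (auto simp: C_def)
    have "(\<Inter>n. C n) \<subseteq> (\<Inter>n. A n)" by (intro INF_superset_mono subset_refl CA)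
    ultimately have "(\<Inter>n. A n) \<noteq> {}" by (metis subset_empty)
    then show False using A(3) by simp
  qed
  note small = this
  show ?thesis
  proof (rule LIMSEQ_I)
    fix e :: real assume "e > 0"
    then obtain n where n: "m (A n) < e" using small by auto
    have "norm (m (A k) - 0) < e" if "k \<ge> n" for k
      using mono[OF decseqD[OF A(2) that] sub] nonneg[OF sub] n by (smt (verit) real_norm_def)
    then show "\<exists>n. \<forall>k\<ge>n. norm (m (A k) - 0) < e" by blast
  qed
qed

text \<open>For a finite content on an algebra, continuity at the empty set amounts to countable
  additivity, so Caratheodory's theorem applies.\<close>

lemma approximable_extension:
  obtains M where "space M = topspace T" "sets M = sigma_sets (topspace T) approximable"
    "\<And>E. E \<in> approximable \<Longrightarrow> emeasure M E = ennreal (m E)"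
proof -
  interpret algebra "topspace T" approximable by (rule approximable_algebra)
  have sub: "E \<subseteq> topspace T" if "E \<in> approximable" for E using that by (auto simp: approximable_def)
  have "\<exists>\<mu>. (\<forall>E\<in>approximable. \<mu> E = ennreal (m E)) \<and>
    measure_space (topspace T) (sigma_sets (topspace T) approximable) \<mu>"
  proof (rule caratheodory_empty_continuous)
    show "positive approximable (\<lambda>E. ennreal (m E))" by (simp add: positive_def empty)
    show "additive approximable (\<lambda>E. ennreal (m E))"
      unfolding additive_def
      by (auto simp: add sub nonneg simp flip: ennreal_plus)
    fix A :: "nat \<Rightarrow> 'b set" assume "range A \<subseteq> approximable" "decseq A" "(\<Inter>i. A i) = {}"
    from approximable_inter_empty[OF this] show "(\<lambda>i. ennreal (m (A i))) \<longlonglongrightarrow> 0"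
      by (metis ennreal_0 tendsto_ennrealI)
  qed auto
  then obtain \<mu> where \<mu>: "\<forall>E\<in>approximable. \<mu> E = ennreal (m E)"
    "measure_space (topspace T) (sigma_sets (topspace T) approximable) \<mu>" by blast
  have ap: "approximable \<subseteq> Pow (topspace T)" using sub by auto
  show ?thesis
  proof
    show "space (measure_of (topspace T) approximable \<mu>) = topspace T" using ap by (rule space_measure_of)
    show "sets (measure_of (topspace T) approximable \<mu>) = sigma_sets (topspace T) approximable"
      using ap by (rule sets_measure_of)
    fix E assume E: "E \<in> approximable"
    then have "E \<in> sigma_sets (topspace T) approximable" by auto
    then have "emeasure (measure_of (topspace T) approximable \<mu>) E = \<mu> E"
      using \<mu>(2) ap unfolding measure_space_def
      by (intro emeasure_measure_of[OF refl]) (auto simp: sets_measure_of)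
    with \<mu>(1) E show "emeasure (measure_of (topspace T) approximable \<mu>) E = ennreal (m E)" by simp
  qed
qed

end

text \<open>A general open set is not known to be in \<open>approximable\<close>; the countable
  union makes it an increasing limit of sets that are.\<close>

lemma second_countable_open_rectangles:
  assumes T: "second_countable T" and T': "second_countable T'"
    and W: "openin (prod_topology T T') W"
  obtains R where "countable R" "W = \<Union>R"
    "\<And>E. E \<in> R \<Longrightarrow> \<exists>U V. openin T U \<and> openin T' V \<and> E = U \<times> V"
proof -
  obtain B where B: "countable B" "\<And>V. V \<in> B \<Longrightarrow> openin T V"
    "\<And>U x. openin T U \<Longrightarrow> x \<in> U \<Longrightarrow> \<exists>V\<in>B. x \<in> V \<and> V \<subseteq> U"
    using T unfolding second_countable_def by metis
  obtain B' where B': "countable B'" "\<And>V. V \<in> B' \<Longrightarrow> openin T' V"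
    "\<And>U x. openin T' U \<Longrightarrow> x \<in> U \<Longrightarrow> \<exists>V\<in>B'. x \<in> V \<and> V \<subseteq> U"
    using T' unfolding second_countable_def by metis
  define R where "R = {E \<in> (\<lambda>(U, V). U \<times> V) ` (B \<times> B'). E \<subseteq> W}"
  have "countable R"
    unfolding R_def by (rule countable_subset[of _ "(\<lambda>(U, V). U \<times> V) ` (B \<times> B')"]) (use B B' in auto)
  moreover have "W = \<Union>R"
  proof
    show "W \<subseteq> \<Union>R"
    proof
      fix w assume "w \<in> W"
      then obtain x y where w: "w = (x, y)" "(x, y) \<in> W" by (cases w) auto
      then obtain U V where UV: "openin T U" "openin T' V" "x \<in> U" "y \<in> V" "U \<times> V \<subseteq> W"
        using W[unfolded openin_prod_topology_alt, rule_format, OF w(2)] by (elim exE conjE)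
      obtain U' V' where "U' \<in> B" "x \<in> U'" "U' \<subseteq> U" "V' \<in> B'" "y \<in> V'" "V' \<subseteq> V"
        using B(3)[OF UV(1,3)] B'(3)[OF UV(2,4)] by auto
      then have "U' \<times> V' \<in> R" "w \<in> U' \<times> V'" using UV(5) w unfolding R_def by auto
      then show "w \<in> \<Union>R" by blast
    qed
  qed (auto simp: R_def)
  moreover have "\<exists>U V. openin T U \<and> openin T' V \<and> E = U \<times> V" if "E \<in> R" for E
    using that B(2) B'(2) by (auto simp: R_def)
  ultimately show ?thesis by (rule that)
qed

text \<open>The content of the complement of a product of two sets is controlled by the marginals,
  which are tight measures. This makes open rectangles approximable and hence m countably additive
  on the algebra of approximable sets.\<close>

lemma joining_of_finitely_additive:
  assumes T: "completely_metrizable_space T" "second_countable T"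
    and \<mu>: "\<mu> \<in> borel_probs T" and \<nu>: "\<nu> \<in> borel_probs T"
    and nonneg: "\<And>E. E \<subseteq> topspace T \<times> topspace T \<Longrightarrow> 0 \<le> m E"
    and add: "\<And>E F. E \<subseteq> topspace T \<times> topspace T \<Longrightarrow> F \<subseteq> topspace T \<times> topspace T \<Longrightarrow>
      E \<inter> F = {} \<Longrightarrow> m (E \<union> F) = m E + m F"
    and m1: "\<And>A. A \<in> sets (borel_of T) \<Longrightarrow> m (A \<times> topspace T) = measure \<mu> A"
    and m2: "\<And>A. A \<in> sets (borel_of T) \<Longrightarrow> m (topspace T \<times> A) = measure \<nu> A"
  obtains M where "M \<in> joinings T \<mu> \<nu>"
    "\<And>W. openin (prod_topology T T) W \<Longrightarrow> measure M W \<le> m W"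
proof -
  let ?X = "topspace T" and ?TT = "prod_topology T T"
  interpret \<mu>: prob_space \<mu> using \<mu> by (simp add: borel_probs_def)
  interpret \<nu>: prob_space \<nu> using \<nu> by (simp add: borel_probs_def)
  have sets_\<mu>: "sets \<mu> = sets (borel_of T)" using \<mu> by (simp add: borel_probs_def)
  have sets_\<nu>: "sets \<nu> = sets (borel_of T)" using \<nu> by (simp add: borel_probs_def)
  have sp: "space \<mu> = ?X" using sets_eq_imp_space_eq[OF sets_\<mu>] by simp
  have Haus: "Hausdorff_space T"
    by (intro metrizable_imp_Hausdorff_space completely_metrizable_imp_metrizable_space T)
  interpret content ?TT m
    by unfold_locales (use nonneg add in auto)
  have rect: "\<exists>K L. compactin ?TT K \<and> K \<subseteq> U \<times> V \<and> compactin ?TT L \<and> L \<subseteq> topspace ?TT - U \<times> V \<and>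
      m (topspace ?TT - (K \<union> L)) < e"
    if U: "openin T U" and V: "openin T V" and e: "e > 0" for U V e
  proof -
    obtain K1 L1 where 1: "compactin T K1" "K1 \<subseteq> U" "compactin T L1" "L1 \<subseteq> ?X - U"
      "measure \<mu> (?X - (K1 \<union> L1)) < e / 2"
      by (rule compact_inner_approx_open[OF T \<mu> U, of "e/2"]) (use e in auto)
    obtain K2 L2 where 2: "compactin T K2" "K2 \<subseteq> V" "compactin T L2" "L2 \<subseteq> ?X - V"
      "measure \<nu> (?X - (K2 \<union> L2)) < e / 2"
      by (rule compact_inner_approx_open[OF T \<nu> V, of "e/2"]) (use e in auto)
    have UV: "U \<subseteq> ?X" "V \<subseteq> ?X" using U V openin_subset by auto
    \<comment> \<open>This L is the part of (K1 \<union> L1) \<times> (K2 \<union> L2) other than K1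
      \<times> K2. Points missed by both have a coordinate outside K1 \<union> L1 or K2 \<union> L2,
      and each marginal charges these with less than e/2.\<close>
    define L where "L = L1 \<times> (K2 \<union> L2) \<union> K1 \<times> L2"
    have meas: "?X - (K1 \<union> L1) \<in> sets (borel_of T)" "?X - (K2 \<union> L2) \<in> sets (borel_of T)"
      by (intro openin_borel_of openin_diff openin_topspace closedin_Un
            compactin_imp_closedin[OF Haus] 1 2)+
    have "m (topspace ?TT - (K1 \<times> K2 \<union> L)) \<le> m ((?X - (K1 \<union> L1)) \<times> ?X \<union> ?X \<times> (?X - (K2 \<union> L2)))"
      by (rule mono) (auto simp: L_def)
    also have "\<dots> \<le> m ((?X - (K1 \<union> L1)) \<times> ?X) + m (?X \<times> (?X - (K2 \<union> L2)))"
      by (rule subadd) auto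
    also have "\<dots> < e" using 1(5) 2(5) by (simp add: m1 m2 meas)
    finally have "m (topspace ?TT - (K1 \<times> K2 \<union> L)) < e" .
    moreover have "compactin ?TT (K1 \<times> K2)" using 1 2 by (simp add: compactin_Times)
    moreover have "compactin ?TT L" unfolding L_def
      using 1 2 by (intro compactin_Un) (auto simp: compactin_Times intro!: compactin_Un)
    moreover have "K1 \<times> K2 \<subseteq> U \<times> V" "L \<subseteq> topspace ?TT - U \<times> V"
      using 1(2,4) 2(2,4) UV by (auto simp: L_def)
    ultimately show ?thesis by blast
  qed
  interpret tight_content ?TT m
  proof
    show "Hausdorff_space ?TT" using Haus by (simp add: Hausdorff_space_prod_topology)
    fix e :: real assume "e > 0"
    \<comment> \<open>For the empty rectangle the inner compact set is empty, so the outer one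
      covers all but e.\<close>
    then obtain L where "compactin ?TT L" "m (topspace ?TT - L) < e"
      using rect[of "{}" "{}" e] by auto
    then show "\<exists>K. compactin ?TT K \<and> m (topspace ?TT - K) < e" by blast
  qed
  have rect_ap: "U \<times> V \<in> approximable" if "openin T U" "openin T V" for U V
    unfolding approximable_def using rect[OF that] that[THEN openin_subset] by auto
  obtain M0 where M0: "space M0 = topspace ?TT" "sets M0 = sigma_sets (topspace ?TT) approximable"
    "\<And>E. E \<in> approximable \<Longrightarrow> emeasure M0 E = ennreal (m E)" by (rule approximable_extension) blast
  have ap0: "E \<in> sets M0" if "E \<in> approximable" for E using that M0(2) by auto
  have open_M0: "W \<in> sets M0 \<and> emeasure M0 W \<le> ennreal (m W)" if W: "openin ?TT W" for W
  proof -
    obtain R where R: "countable R" "W = \<Union>R"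
      "\<And>E. E \<in> R \<Longrightarrow> \<exists>U V. openin T U \<and> openin T V \<and> E = U \<times> V"
      using second_countable_open_rectangles[OF T(2) T(2) W] by metis
    have R_ap: "E \<in> approximable" if "E \<in> R" for E using R(3)[OF that] rect_ap by auto
    have WT: "W \<subseteq> topspace ?TT" by (rule openin_subset[OF W])
    show ?thesis
    proof (cases "R = {}")
      case True
      then show ?thesis using R by simp
    next
      case False
      define r where "r = from_nat_into R"
      have r: "range r = R" unfolding r_def using range_from_nat_into[OF False R(1)] .
      have U_ap: "(\<Union>i\<le>n. r i) \<in> approximable" for n
      proof (induction n)
        case 0 then show ?case using r R_ap by auto
      next
        case (Suc n)
        have "r (Suc n) \<in> approximable" using r R_ap by auto
        from approximable_Un[OF this Suc] show ?case by (simp add: atMost_Suc)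
      qed
      have WU: "W = (\<Union>n. \<Union>i\<le>n. r i)" using R(2) r by auto
      \<comment> \<open>\<open>M0\<close> is continuous from below, whereas m is only monotone along
        the union; this is the source of the inequality.\<close>
      have "emeasure M0 W = (SUP n. emeasure M0 (\<Union>i\<le>n. r i))"
        unfolding WU
        by (rule SUP_emeasure_incseq[symmetric]) (use ap0 U_ap in \<open>auto intro!: incseq_SucI simp: atMost_Suc\<close>)
      also have "\<dots> \<le> ennreal (m W)"
      proof (rule SUP_least)
        fix n
        have "m (\<Union>i\<le>n. r i) \<le> m W" by (rule mono[OF _ WT]) (auto simp: WU)
        then show "emeasure M0 (\<Union>i\<le>n. r i) \<le> ennreal (m W)"
          unfolding M0(3)[OF U_ap] by (rule ennreal_leI)
      qed
      finally have "emeasure M0 W \<le> ennreal (m W)" .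
      moreover have "W \<in> sets M0" unfolding WU using ap0 U_ap by (intro sets.countable_UN) auto
      ultimately show ?thesis by simp
    qed
  qed
  \<comment> \<open>The sigma-algebra of \<open>M0\<close> contains the Borel sets but may be
    larger; pushing forward along the identity restricts the measure to the Borel sets.\<close>
  have id: "(\<lambda>z. z) \<in> measurable M0 (borel_of ?TT)"
    unfolding borel_of_def
  proof (rule measurable_measure_of)
    fix W assume "W \<in> {U. openin ?TT U}"
    then have "openin ?TT W" by simp
    then show "(\<lambda>z. z) -` W \<inter> space M0 \<in> sets M0"
      using open_M0[of W] openin_subset[of ?TT W] M0(1) by (simp add: Int_absorb2)
  qed (use M0(1) in \<open>auto dest: openin_subset simp del: topspace_prod_topology\<close>)
  define M where "M = distr M0 (borel_of ?TT) (\<lambda>z. z)"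
  have M_open: "emeasure M W = emeasure M0 W" if "openin ?TT W" for W
    unfolding M_def using openin_subset[OF that] M0(1)
    by (subst emeasure_distr[OF id openin_borel_of[OF that]]) (simp add: Int_absorb2)
  have spM: "space M = topspace ?TT" and setsM: "sets M = sets (borel_of ?TT)" by (auto simp: M_def)
  have opX: "openin ?TT (topspace ?TT)" by (rule openin_topspace)
  have one: "m (?X \<times> ?X) = 1"
    using m1[of ?X] \<mu>.prob_space sp openin_borel_of[OF openin_topspace, of T] by simp
  have "emeasure M (space M) = 1"
    using M_open[OF opX] M0(3)[OF rect_ap[OF openin_topspace openin_topspace]] spM one by simp
  then interpret M: prob_space M by (rule prob_spaceI)
  \<comment> \<open>Comparison on the intersection-stable generator of open sets is enough. The
    preimages there are open rectangles U \<times> X or X \<times> U, on which M agrees with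
    m.\<close>
  have gen: "distr M (borel_of T) f = \<rho>"
    if f: "continuous_map ?TT T f" and \<rho>: "\<rho> \<in> borel_probs T"
      and eq: "\<And>U. openin T U \<Longrightarrow> emeasure M (f -` U \<inter> space M) = emeasure \<rho> U" for f \<rho>
  proof (rule measure_eqI_generator_eq[where E = "{U. openin T U}" and \<Omega> = ?X and A = "\<lambda>_. ?X"])
    have fm: "f \<in> measurable M (borel_of T)"
      using continuous_map_measurable_borel_of[OF f] setsM by (simp cong: measurable_cong_sets)
    show "Int_stable {U. openin T U}" by (auto simp: Int_stable_def)
    show "{U. openin T U} \<subseteq> Pow ?X" using openin_subset by auto
    show "emeasure (distr M (borel_of T) f) U = emeasure \<rho> U" if "U \<in> {U. openin T U}" for U
      using that by (simp add: emeasure_distr[OF fm openin_borel_of] eq)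
    show "sets (distr M (borel_of T) f) = sigma_sets ?X {U. openin T U}" by (simp add: sets_borel_of)
    show "sets \<rho> = sigma_sets ?X {U. openin T U}" using \<rho> by (simp add: borel_probs_def sets_borel_of)
    interpret d: prob_space "distr M (borel_of T) f" by (rule M.prob_space_distr[OF fm])
    show "emeasure (distr M (borel_of T) f) ?X \<noteq> \<infinity>" by simp
  qed auto
  have "distr M (borel_of T) fst = \<mu>"
  proof (rule gen[OF continuous_map_fst \<mu>])
    fix U assume U: "openin T U"
    have eqU: "fst -` U \<inter> space M = U \<times> ?X" using openin_subset[OF U] spM by auto
    have "openin ?TT (U \<times> ?X)" using U by (simp add: openin_prod_Times_iff)
    then show "emeasure M (fst -` U \<inter> space M) = emeasure \<mu> U"
      unfolding eqU using M_open M0(3)[OF rect_ap[OF U openin_topspace]] m1[OF openin_borel_of[OF U]]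
      by (simp add: \<mu>.emeasure_eq_measure)
  qed
  moreover have "distr M (borel_of T) snd = \<nu>"
  proof (rule gen[OF continuous_map_snd \<nu>])
    fix U assume U: "openin T U"
    have eqU: "snd -` U \<inter> space M = ?X \<times> U" using openin_subset[OF U] spM by auto
    have "openin ?TT (?X \<times> U)" using U by (simp add: openin_prod_Times_iff)
    then show "emeasure M (snd -` U \<inter> space M) = emeasure \<nu> U"
      unfolding eqU using M_open M0(3)[OF rect_ap[OF openin_topspace U]] m2[OF openin_borel_of[OF U]]
      by (simp add: \<nu>.emeasure_eq_measure)
  qed
  ultimately have "M \<in> joinings T \<mu> \<nu>"
    using M.prob_space_axioms setsM by (simp add: joinings_def borel_probs_def)
  moreover have "measure M W \<le> m W" if W: "openin ?TT W" for W
  proof -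
    have "W \<subseteq> ?X \<times> ?X" using openin_subset[OF W] by simp
    then have "0 \<le> m W" by (rule assms(5))
    moreover have "ennreal (measure M W) \<le> ennreal (m W)"
      using open_M0[OF W] M_open[OF W] by (simp add: M.emeasure_eq_measure)
    ultimately show ?thesis by simp
  qed
  ultimately show ?thesis by (rule that)
qed

subsection \<open>Integrals of continuous functions\<close>

lemma continuous_map_real_iff:
  "continuous_map T euclideanreal f \<longleftrightarrow>
    (\<forall>x\<in>topspace T. \<forall>e>0. \<exists>U. openin T U \<and> x \<in> U \<and> (\<forall>y\<in>U. \<bar>f x - f y\<bar> < e))"
  using Met_TC.continuous_map_to_metric[of T f] by (simp add: dist_real_def)

lemma continuous_map_prod_mdist:
  "continuous_map (prod_topology (mtopology_of m) (mtopology_of m)) euclideanreal (\<lambda>(x, y). mdist m x y)"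
  unfolding continuous_map_real_iff
proof clarsimp
  fix x y and e :: real assume xy: "x \<in> mspace m" "y \<in> mspace m" and e: "e > 0"
  let ?U = "mball_of m x (e/2) \<times> mball_of m y (e/2)"
  interpret Metric_space "mspace m" "mdist m" by simp
  have op: "openin (mtopology_of m) (mball_of m z (e/2))" for z
    by (simp add: mtopology_of_def mball_of_def)
  have "\<bar>mdist m x y - mdist m x' y'\<bar> < e" if "(x', y') \<in> ?U" for x' y'
    using that triangle[of x x' y] triangle[of x' y' y] triangle[of x' x y'] triangle[of x y y'] xy
    by (auto simp: commute)
  moreover have "openin (prod_topology (mtopology_of m) (mtopology_of m)) ?U"
    using op by (simp add: openin_prod_Times_iff)
  moreover have "(x, y) \<in> ?U" using xy e by simp
  ultimately show "\<exists>U. openin (prod_topology (mtopology_of m) (mtopology_of m)) U \<and> (x, y) \<in> U \<and>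
    (\<forall>z\<in>U. \<bar>mdist m x y - (case z of (x, y) \<Rightarrow> mdist m x y)\<bar> < e)"
    by (intro exI[of _ ?U]) auto
qed

text \<open>The count is the ceiling of y minus 1, and 0 for y = 0. The strict
  \<open>real k < y\<close> corresponds to superlevel sets {g > k/n}, which are open for continuous
  g.\<close>

lemma card_less_real:
  assumes "0 \<le> y" "y \<le> real N"
  shows "real (card {k\<in>{1..N}. real k < y}) \<le> y" "y \<le> 1 + real (card {k\<in>{1..N}. real k < y})"
proof -
  have "{k\<in>{1..N}. real k < y} = {1..nat (\<lceil>y\<rceil> - 1)}"
    using assms by (auto simp: le_nat_iff) linarith+
  then have "card {k\<in>{1..N}. real k < y} = nat (\<lceil>y\<rceil> - 1)" by simp
  then show "real (card {k\<in>{1..N}. real k < y}) \<le> y" "y \<le> 1 + real (card {k\<in>{1..N}. real k < y})"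
    using assms by linarith+
qed

locale positive_functional =
  fixes \<Omega> :: "'b set" and L :: "('b \<Rightarrow> real) \<Rightarrow> real"
  assumes linear: "linear_on_funs (bounded_funs \<Omega>) L"
    and pos: "f \<in> bounded_funs \<Omega> \<Longrightarrow> (\<And>z. z \<in> \<Omega> \<Longrightarrow> 0 \<le> f z) \<Longrightarrow> 0 \<le> L f"
begin

lemma L_add: "f \<in> bounded_funs \<Omega> \<Longrightarrow> g \<in> bounded_funs \<Omega> \<Longrightarrow> L (\<lambda>z. f z + g z) = L f + L g"
  using linear by (simp add: linear_on_funs_def)

lemma L_scale: "f \<in> bounded_funs \<Omega> \<Longrightarrow> L (\<lambda>z. c * f z) = c * L f"
  using linear by (simp add: linear_on_funs_def)

lemma L_mono:
  assumes f: "f \<in> bounded_funs \<Omega>" and g: "g \<in> bounded_funs \<Omega>" and le: "\<And>z. z \<in> \<Omega> \<Longrightarrow> f z \<le> g z"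
  shows "L f \<le> L g"
proof -
  have "0 \<le> L (\<lambda>z. g z + (-1) * f z)"
    by (intro pos bounded_funs_add bounded_funs_scale f g) (use le in simp)
  also have "\<dots> = L g + L (\<lambda>z. (-1) * f z)" by (intro L_add bounded_funs_scale f g)
  also have "\<dots> = L g - L f" using L_scale[OF f, of "-1"] by simp
  finally show ?thesis by simp
qed

text \<open>Positivity is tested on \<Omega> only, so L does not see values off \<Omega>, which
  \<open>bounded_funs\<close> leaves arbitrary.\<close>

lemma L_cong:
  assumes "f \<in> bounded_funs \<Omega>" "\<And>z. z \<in> \<Omega> \<Longrightarrow> f z = g z"
  shows "L f = L g"
proof -
  have "g \<in> bounded_funs \<Omega>" using assms by (auto simp: bounded_funs_def)
  then show ?thesis using assms by (intro antisym L_mono) auto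
qed

lemma indicator_bounded: "indicator E \<in> bounded_funs \<Omega>"
  by (rule bounded_funsI[of _ _ 1]) (auto simp: indicator_def)

lemma L_sum:
  assumes "finite I" "\<And>i. i \<in> I \<Longrightarrow> f i \<in> bounded_funs \<Omega>"
  shows "(\<lambda>z. \<Sum>i\<in>I. f i z) \<in> bounded_funs \<Omega> \<and> L (\<lambda>z. \<Sum>i\<in>I. f i z) = (\<Sum>i\<in>I. L (f i))"
  using assms
proof (induction I rule: finite_induct)
  case empty
  have "(\<lambda>z. 0) \<in> bounded_funs \<Omega>" by (rule bounded_funsI[of _ _ 0]) simp
  then show ?case using L_scale[of "\<lambda>z. 0" 0] by simp
next
  case (insert i I)
  then show ?case using L_add[of "f i" "\<lambda>z. \<Sum>i\<in>I. f i z"] by (simp add: bounded_funs_add)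
qed

text \<open>A layer-cake sum: the staircase s = (1/n) \<Sum> indicator {g > k/n} satisfies s \<le> g
  \<le> s + 1/n and involves open sets only. The error 1/n is paid on the side of the probability M,
  and L s \<le> L g by positivity.\<close>

lemma integral_le_L:
  assumes M: "prob_space M" "sets M = sets (borel_of T)" and \<Omega>: "\<Omega> = topspace T"
    and le: "\<And>W. openin T W \<Longrightarrow> measure M W \<le> L (indicator W)"
    and g: "continuous_map T euclideanreal g" and g0: "\<And>z. z \<in> \<Omega> \<Longrightarrow> 0 \<le> g z"
    and R: "\<And>z. z \<in> \<Omega> \<Longrightarrow> g z \<le> R"
  shows "(\<integral>z. g z \<partial>M) \<le> L g"
proof -
  interpret prob_space M by fact
  have sp: "space M = \<Omega>" using sets_eq_imp_space_eq[OF M(2)] \<Omega> by simp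
  have meas: "W \<in> sets M" if "openin T W" for W using openin_borel_of[OF that] M(2) by simp
  have gB: "g \<in> bounded_funs \<Omega>" by (rule bounded_funsI[of _ _ R]) (use g0 R in auto)
  have gm: "g \<in> borel_measurable M"
    using continuous_map_borel_measurable[OF g] M(2) by (simp cong: measurable_cong_sets)
  have gi: "integrable M g"
    by (rule integrable_const_bound[of _ R]) (use gm g0 R sp in auto)
  have main: "(\<integral>z. g z \<partial>M) \<le> 1 / real n + L g" if n: "n > 0" for n :: nat
  proof -
    \<comment> \<open>N is at least n * R, so the thresholds k/n reach up to the bound of g.\<close>
    define N where "N = nat \<lceil>real n * R\<rceil>"
    define W where "W k = {z \<in> topspace T. g z \<in> {real k / real n<..}}" for k :: nat
    define s where "s z = (\<Sum>k\<in>{1..N}. (1 / real n) * indicator (W k) z)" for z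
    have Wop: "openin T (W k)" for k
      unfolding W_def by (rule openin_continuous_map_preimage[OF g]) simp
    have s_eq: "s z = real (card {k\<in>{1..N}. real k < real n * g z}) / real n" if z: "z \<in> \<Omega>" for z
    proof -
      have "s z = (1 / real n) * (\<Sum>k\<in>{1..N}. if real k < real n * g z then 1 else 0)"
        unfolding s_def sum_distrib_left
        by (intro sum.cong refl) (use z \<Omega> n in \<open>auto simp: W_def indicator_def field_simps\<close>)
      also have "(\<Sum>k\<in>{1..N}. if real k < real n * g z then 1 else (0::real)) =
        real (card {k\<in>{1..N}. real k < real n * g z})"
        by (subst sum.inter_filter[symmetric]) auto
      finally show ?thesis by simp
    qed
    have bnd: "0 \<le> real n * g z" "real n * g z \<le> real N" if z: "z \<in> \<Omega>" for z
    proof -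
      show "0 \<le> real n * g z" using g0[OF z] by simp
      have "real n * g z \<le> real n * R" using R[OF z] by (simp add: mult_left_mono)
      also have "\<dots> \<le> real N" unfolding N_def by linarith
      finally show "real n * g z \<le> real N" .
    qed
    have s_le: "s z \<le> g z" and g_le: "g z \<le> 1 / real n + s z" if z: "z \<in> \<Omega>" for z
      using card_less_real[OF bnd[OF z]] n unfolding s_eq[OF z] by (auto simp: field_simps)
    have sI: "(\<lambda>z. \<Sum>k\<in>{1..N}. (1 / real n) * indicator (W k) z) \<in> bounded_funs \<Omega> \<and>
       L (\<lambda>z. \<Sum>k\<in>{1..N}. (1 / real n) * indicator (W k) z) = (\<Sum>k\<in>{1..N}. L (\<lambda>z. (1 / real n) * indicator (W k) z))"
      by (intro L_sum bounded_funs_scale indicator_bounded finite_atLeastAtMost)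
    have iW: "integrable M (\<lambda>z. (1 / real n) * indicator (W k) z :: real)" for k
      using meas[OF Wop] by (intro integrable_mult_right integrable_real_indicator) (auto simp: less_top[symmetric])
    have s_int: "integrable M s" unfolding s_def by (intro Bochner_Integration.integrable_sum iW)
    have "(\<integral>z. g z \<partial>M) \<le> (\<integral>z. 1 / real n + s z \<partial>M)"
      by (rule integral_mono) (use gi s_int g_le sp in auto)
    also have "\<dots> = 1 / real n + (\<integral>z. s z \<partial>M)" using s_int by (simp add: prob_space)
    also have "(\<integral>z. s z \<partial>M) = (\<Sum>k\<in>{1..N}. (1 / real n) * measure M (W k))"
      unfolding s_def by (subst Bochner_Integration.integral_sum) (use iW meas[OF Wop] in auto)
    also have "\<dots> \<le> (\<Sum>k\<in>{1..N}. (1 / real n) * L (indicator (W k)))"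
      by (intro sum_mono mult_left_mono le Wop) simp
    also have "\<dots> = L s"
      using sI unfolding s_def[abs_def] L_scale[OF indicator_bounded] by (simp only:)
    also have "L s \<le> L g"
      by (rule L_mono) (use sI gB s_le in \<open>simp_all only: s_def[abs_def]\<close>)
    finally show ?thesis by simp
  qed
  show ?thesis
  proof (rule field_le_epsilon)
    fix e :: real assume "e > 0"
    then obtain n where "inverse (real (Suc n)) < e" using reals_Archimedean by blast
    with main[of "Suc n"] show "(\<integral>z. g z \<partial>M) \<le> L g + e" by (simp add: inverse_eq_divide)
  qed
qed

end

text \<open>The witness f x = inf over y of v y + c x y is the c-transform: y = x gives f \<le> v,
  the hypothesis \<open>uv\<close> gives -u \<le> f, and the triangle inequality gives the Lipschitz
  bound.\<close>

lemma inf_convolution: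
  fixes c :: "'b \<Rightarrow> 'b \<Rightarrow> real"
  assumes c0: "\<And>x. x \<in> A \<Longrightarrow> c x x = 0"
    and c_nonneg: "\<And>x y. x \<in> A \<Longrightarrow> y \<in> A \<Longrightarrow> 0 \<le> c x y"
    and tri: "\<And>x y z. x \<in> A \<Longrightarrow> y \<in> A \<Longrightarrow> z \<in> A \<Longrightarrow> c x z \<le> c x y + c y z"
    and v: "v \<in> bounded_funs A"
    and uv: "\<And>x y. x \<in> A \<Longrightarrow> y \<in> A \<Longrightarrow> 0 \<le> u x + v y + c x y"
  obtains f where "\<And>x. x \<in> A \<Longrightarrow> f x \<le> v x" "\<And>x. x \<in> A \<Longrightarrow> - u x \<le> f x"
    "\<And>x y. x \<in> A \<Longrightarrow> y \<in> A \<Longrightarrow> f x - f y \<le> c x y" "f \<in> bounded_funs A"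
proof -
  define f where "f x = (INF y\<in>A. v y + c x y)" for x
  obtain C where C: "\<And>x. x \<in> A \<Longrightarrow> \<bar>v x\<bar> \<le> C" using v by (auto simp: bounded_funs_def)
  have low: "- C \<le> v y + c x y" if "x \<in> A" "y \<in> A" for x y
    using C[OF that(2)] c_nonneg[OF that] by linarith
  have le: "f x \<le> v y + c x y" if "x \<in> A" "y \<in> A" for x y
    unfolding f_def using that low[OF that(1)] by (intro cINF_lower bdd_belowI2[of _ "-C"]) auto
  have ge: "a \<le> f x" if "x \<in> A" "\<And>y. y \<in> A \<Longrightarrow> a \<le> v y + c x y" for x a
    unfolding f_def by (rule cINF_greatest) (use that in auto)
  have fv: "f x \<le> v x" if "x \<in> A" for x using le[OF that that] c0[OF that] by simp
  show ?thesis
  proof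
    show "- u x \<le> f x" if "x \<in> A" for x using uv[OF that] by (intro ge that) (smt (verit))
    show "f x - f y \<le> c x y" if "x \<in> A" "y \<in> A" for x y
    proof -
      have "f x - c x y \<le> f y"
      proof (rule ge[OF that(2)])
        fix z assume z: "z \<in> A"
        show "f x - c x y \<le> v z + c y z" using le[OF that(1) z] tri[OF that z] by linarith
      qed
      then show ?thesis by simp
    qed
    show "f \<in> bounded_funs A"
    proof (rule bounded_funsI)
      fix x assume x: "x \<in> A"
      have "- C \<le> f x" by (rule ge[OF x]) (use low x in auto)
      then show "\<bar>f x\<bar> \<le> C" using fv[OF x] C[OF x] by linarith
    qed
  qed (rule fv)
qed

subsection \<open>The Dobrushin distance is at most the Steif distance\<close>

text \<open>Written as an integral over the counting measure, the sum over coordinates can be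
  exchanged with the integral against a joining.\<close>

lemma infsum_eq_nn_integral_count_space:
  fixes f :: "'i \<Rightarrow> ennreal"
  assumes S: "countable S"
  shows "infsum f S = (\<integral>\<^sup>+s. f s \<partial>count_space S)"
proof (rule antisym)
  have eq: "infsum f S = (SUP F\<in>{F. finite F \<and> F \<subseteq> S}. sum f F)"
    by (rule nonneg_infsum_complete) simp
  show "infsum f S \<le> (\<integral>\<^sup>+s. f s \<partial>count_space S)"
    unfolding eq
  proof (rule SUP_least)
    fix F assume F: "F \<in> {F. finite F \<and> F \<subseteq> S}"
    then have "sum f F = (\<integral>\<^sup>+s. f s * indicator F s \<partial>count_space S)"
      by (subst nn_integral_count_space'[of F]) auto
    also have "\<dots> \<le> (\<integral>\<^sup>+s. f s \<partial>count_space S)"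
      by (intro nn_integral_mono) (auto simp: indicator_def)
    finally show "sum f F \<le> (\<integral>\<^sup>+s. f s \<partial>count_space S)" .
  qed
  show "(\<integral>\<^sup>+s. f s \<partial>count_space S) \<le> infsum f S"
  proof (cases "finite S")
    case True
    then show ?thesis by (simp add: nn_integral_count_space_finite)
  next
    case False
    note b = bij_betw_from_nat_into[OF S False]
    have "(\<integral>\<^sup>+s. f s \<partial>count_space S) = (\<Sum>n. f (from_nat_into S n))"
      by (simp add: nn_integral_bij_count_space[OF b, symmetric] nn_integral_count_space_nat)
    also have "\<dots> = (SUP n. \<Sum>i<n. f (from_nat_into S i))" by (rule suminf_eq_SUP)
    also have "\<dots> \<le> infsum f S"
    proof (rule SUP_least)
      fix n
      have "(\<Sum>i<n. f (from_nat_into S i)) = sum f (from_nat_into S ` {..<n})"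
        using b by (subst sum.reindex) (auto simp: bij_betw_def intro: inj_on_subset)
      also have "\<dots> \<le> infsum f S" unfolding eq
        by (rule SUP_upper) (use b in \<open>auto simp: bij_betw_def\<close>)
      finally show "(\<Sum>i<n. f (from_nat_into S i)) \<le> infsum f S" .
    qed
    finally show ?thesis .
  qed
qed

text \<open>\<open>ennreal\<close> truncates at 0, so equality is lost when a and b have opposite
  signs.\<close>

lemma ennreal_add_le: "ennreal (a + b) \<le> ennreal a + ennreal b"
proof -
  have "ennreal (a + b) \<le> ennreal (max 0 a + max 0 b)" by (rule ennreal_leI) simp
  also have "\<dots> = ennreal (max 0 a) + ennreal (max 0 b)" by (rule ennreal_plus) auto
  also have "\<dots> = ennreal a + ennreal b" by (simp add: max_def ennreal_neg)
  finally show ?thesis .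
qed

lemma ennreal_integral_le_nn_integral:
  assumes "integrable M f"
  shows "ennreal (\<integral>x. f x \<partial>M) \<le> (\<integral>\<^sup>+x. ennreal (f x) \<partial>M)"
proof -
  have "(\<integral>x. f x \<partial>M) \<le> (\<integral>x. max 0 (f x) \<partial>M)"
    by (intro integral_mono integrable_max assms) auto
  then have "ennreal (\<integral>x. f x \<partial>M) \<le> ennreal (\<integral>x. max 0 (f x) \<partial>M)" by (rule ennreal_leI)
  also have "\<dots> = (\<integral>\<^sup>+x. ennreal (max 0 (f x)) \<partial>M)"
    by (rule nn_integral_eq_integral[symmetric]) (use assms in auto)
  also have "\<dots> = (\<integral>\<^sup>+x. ennreal (f x) \<partial>M)"
    by (intro nn_integral_cong) (auto simp: max_def ennreal_neg)
  finally show ?thesis .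
qed

section \<open>Countable products of Polish spaces with uniformly bounded diameters\<close>

locale bounded_polish_family =
  fixes S :: "'i set" and X :: "'i \<Rightarrow> 'a metric"
  assumes countable: "countable S"
    and complete: "s \<in> S \<Longrightarrow> mcomplete_of (X s)"
    and separable: "s \<in> S \<Longrightarrow> separable_space (mtopology_of (X s))"
    and diam: "(SUP s\<in>S. metric_diam (X s)) < \<infinity>"
begin

abbreviation "T \<equiv> prod_space S X"
abbreviation "coord_dist s x y \<equiv> mdist (X s) (x s) (y s)"

lemma topspace_T: "topspace T = (\<Pi>\<^sub>E s\<in>S. mspace (X s))"
  by (simp add: prod_space_def)

lemma completely_metrizable_T: "completely_metrizable_space T"
proof -
  have "completely_metrizable_space (mtopology_of (X s))" if "s \<in> S" for s
    using complete[OF that] Metric_space.completely_metrizable_space_mtopology[of "mspace (X s)" "mdist (X s)"]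
    by (simp add: mtopology_of_def mcomplete_of_def)
  then show ?thesis
    using countable by (auto simp: prod_space_def completely_metrizable_space_product_topology)
qed

lemma second_countable_T: "second_countable T"
  unfolding prod_space_def
  by (intro second_countable_product_topology countable second_countable_metric separable)

lemma coord_dist_bounded:
  obtains R where "\<And>s x y. s \<in> S \<Longrightarrow> x \<in> topspace T \<Longrightarrow> y \<in> topspace T \<Longrightarrow> coord_dist s x y \<le> R"
proof
  fix s x y assume s: "s \<in> S" and x: "x \<in> topspace T" and y: "y \<in> topspace T"
  have "ennreal (coord_dist s x y) \<le> metric_diam (X s)"
    unfolding metric_diam_def using s x y
    by (intro SUP_upper2[of "x s"] SUP_upper2[of "y s"]) (auto simp: topspace_T PiE_iff)
  also have "\<dots> \<le> (SUP s\<in>S. metric_diam (X s))" using s by (rule SUP_upper)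
  also have "\<dots> = ennreal (enn2real (SUP s\<in>S. metric_diam (X s)))" using diam by simp
  finally show "coord_dist s x y \<le> enn2real (SUP s\<in>S. metric_diam (X s))" by simp
qed

lemma continuous_coord_dist:
  assumes s: "s \<in> S"
  shows "continuous_map (prod_topology T T) euclideanreal (\<lambda>z. coord_dist s (fst z) (snd z))"
proof -
  have p: "continuous_map T (mtopology_of (X s)) (\<lambda>x. x s)"
    unfolding prod_space_def by (rule continuous_map_product_projection[OF s])
  have "continuous_map (prod_topology T T) (prod_topology (mtopology_of (X s)) (mtopology_of (X s)))
      (\<lambda>z. (fst z s, snd z s))"
    using continuous_map_compose[OF continuous_map_fst p, of T]
      continuous_map_compose[OF continuous_map_snd p, of T]
    by (intro continuous_map_pairedI) (simp_all add: o_def)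
  from continuous_map_compose[OF this continuous_map_prod_mdist] show ?thesis by (simp add: o_def)
qed

text \<open>Points of the product are extensional on S, so points that agree off s must differ at s.
  Hence the quotients in \<open>partial_lipschitz\<close> do not divide by 0.\<close>

lemma coord_dist_pos:
  assumes "s \<in> S" "x \<in> topspace T" "y \<in> topspace T" "x \<noteq> y" "\<And>t. t \<in> S - {s} \<Longrightarrow> x t = y t"
  shows "0 < coord_dist s x y"
proof -
  have "x s \<noteq> y s"
  proof
    assume "x s = y s"
    then have "x = y" using assms by (intro PiE_ext[of x S _ y]) (auto simp: topspace_T)
    with assms show False by simp
  qed
  moreover have "x s \<in> mspace (X s)" "y s \<in> mspace (X s)" using assms by (auto simp: topspace_T)
  ultimately show ?thesis by (metis mdist_zero mdist_nonneg less_eq_real_def)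
qed

lemma partial_lipschitz_bound:
  assumes s: "s \<in> S" and x: "x \<in> topspace T" and y: "y \<in> topspace T"
    and agree: "\<And>t. t \<in> S - {s} \<Longrightarrow> x t = y t"
  shows "ennreal (f x - f y) \<le> partial_lipschitz S X f s * ennreal (coord_dist s x y)"
proof (cases "x = y")
  case False
  have d: "coord_dist s x y > 0" by (rule coord_dist_pos[OF s x y False agree])
  have "ennreal ((f x - f y) / coord_dist s x y) \<le> partial_lipschitz S X f s"
    unfolding partial_lipschitz_def by (rule SUP_upper2[of "(x, y)"]) (use x y agree False in auto)
  then have "ennreal ((f x - f y) / coord_dist s x y) * ennreal (coord_dist s x y) \<le>
      partial_lipschitz S X f s * ennreal (coord_dist s x y)" by (rule mult_right_mono) simp
  also have "ennreal ((f x - f y) / coord_dist s x y) * ennreal (coord_dist s x y) = ennreal (f x - f y)"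
    using d by (simp flip: ennreal_mult'')
  finally show ?thesis .
qed simp

text \<open>Change coordinates one at a time; continuity of \<open>f\<close> passes to infinitely many changes.\<close>
lemma difference_le_sum_partial_lipschitz:
  assumes f: "continuous_map T euclideanreal f" and x: "x \<in> topspace T" and y: "y \<in> topspace T"
  shows "ennreal (f x - f y) \<le> (\<integral>\<^sup>+s. partial_lipschitz S X f s * ennreal (coord_dist s x y) \<partial>count_space S)"
    (is "_ \<le> ?B")
proof -
  let ?g = "\<lambda>s. partial_lipschitz S X f s * ennreal (coord_dist s x y)"
  define z where "z F = (\<lambda>s. if s \<in> F then y s else x s)" for F
  have zT: "z F \<in> topspace T" if "F \<subseteq> S" for F
    using x y that by (auto simp: topspace_T z_def PiE_iff extensional_def)
  have fin: "ennreal (f x - f (z F)) \<le> sum ?g F" if "finite F" "F \<subseteq> S" for F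
    using that
  proof (induction F rule: finite_induct)
    case empty
    then show ?case by (simp add: z_def)
  next
    case (insert s F)
    have "ennreal (f x - f (z (insert s F))) = ennreal ((f x - f (z F)) + (f (z F) - f (z (insert s F))))"
      by simp
    also have "\<dots> \<le> ennreal (f x - f (z F)) + ennreal (f (z F) - f (z (insert s F)))" by (rule ennreal_add_le)
    also have "ennreal (f (z F) - f (z (insert s F))) \<le>
        partial_lipschitz S X f s * ennreal (coord_dist s (z F) (z (insert s F)))"
      by (rule partial_lipschitz_bound[OF _ zT zT]) (use insert.prems in \<open>auto simp: z_def\<close>)
    also have "coord_dist s (z F) (z (insert s F)) = coord_dist s x y" using insert.hyps by (simp add: z_def)
    also have "ennreal (f x - f (z F)) \<le> sum ?g F" using insert by simp
    finally show ?case using insert.hyps by (simp add: add.commute)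
  qed
  \<comment> \<open>Along finite subsets F of S every coordinate of \<open>z F\<close> is eventually
    that of y, and convergence in the product is coordinatewise.\<close>
  have "limitin T z y (finite_subsets_at_top S)"
    unfolding prod_space_def limitin_componentwise
  proof (intro conjI ballI)
    show "y \<in> extensional S" using y by (auto simp: topspace_T PiE_iff)
    show "\<forall>\<^sub>F F in finite_subsets_at_top S. z F \<in> topspace (product_topology (\<lambda>s. mtopology_of (X s)) S)"
      using zT by (intro eventually_finite_subsets_at_top_weakI) (simp add: prod_space_def)
    fix s assume s: "s \<in> S"
    have "\<forall>\<^sub>F F in finite_subsets_at_top S. y s = z F s"
      unfolding eventually_finite_subsets_at_top using s by (intro exI[of _ "{s}"]) (auto simp: z_def)
    moreover have "limitin (mtopology_of (X s)) (\<lambda>F. y s) (y s) (finite_subsets_at_top S)"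
      using s y by (auto simp: topspace_T)
    ultimately show "limitin (mtopology_of (X s)) (\<lambda>F. z F s) (y s) (finite_subsets_at_top S)"
      by (rule limitin_transform_eventually)
  qed
  from continuous_map_limit[OF f this]
  have "((\<lambda>F. f (z F)) \<longlongrightarrow> f y) (finite_subsets_at_top S)" by (simp add: o_def)
  then have "((\<lambda>F. ennreal (f x - f (z F))) \<longlongrightarrow> ennreal (f x - f y)) (finite_subsets_at_top S)"
    by (intro tendsto_ennrealI tendsto_intros)
  moreover have "\<forall>\<^sub>F F in finite_subsets_at_top S. ennreal (f x - f (z F)) \<le> ?B"
  proof (rule eventually_finite_subsets_at_top_weakI)
    fix F assume F: "finite F" "F \<subseteq> S"
    have "sum ?g F \<le> infsum ?g S"
      using F by (subst nonneg_infsum_complete) (auto intro: SUP_upper)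
    with fin[OF F] show "ennreal (f x - f (z F)) \<le> ?B"
      unfolding infsum_eq_nn_integral_count_space[OF countable] by (rule order_trans)
  qed
  ultimately show ?thesis
    by (rule tendsto_upperbound) simp
qed

lemma dobrushin_norm_eq: "dobrushin_norm S X f = (\<integral>\<^sup>+s. partial_lipschitz S X f s \<partial>count_space S)"
  by (simp add: dobrushin_norm_def infsum_eq_nn_integral_count_space[OF countable])

text \<open>Coordinate s contributes at most R times its partial Lipschitz constant, so the
  oscillation of f is at most R times the norm. The uniform diameter bound thus makes the integrals
  of f exist.\<close>

lemma dobrushin_smooth_bounded:
  assumes f: "f \<in> dobrushin_smooth S X"
  shows "f \<in> bounded_funs (topspace T)"
proof (cases "topspace T = {}")
  case False
  then obtain x0 where x0: "x0 \<in> topspace T" by blast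
  obtain R where R: "\<And>s x y. s \<in> S \<Longrightarrow> x \<in> topspace T \<Longrightarrow> y \<in> topspace T \<Longrightarrow> coord_dist s x y \<le> R"
    using coord_dist_bounded by blast
  define C where "C = enn2real (dobrushin_norm S X f * ennreal R)"
  have le: "f x - f y \<le> C" if "x \<in> topspace T" "y \<in> topspace T" for x y
  proof -
    have "ennreal (f x - f y) \<le> (\<integral>\<^sup>+s. partial_lipschitz S X f s * ennreal (coord_dist s x y) \<partial>count_space S)"
      using f that by (intro difference_le_sum_partial_lipschitz) (auto simp: dobrushin_smooth_def)
    also have "\<dots> \<le> (\<integral>\<^sup>+s. partial_lipschitz S X f s * ennreal R \<partial>count_space S)"
      by (intro nn_integral_mono mult_left_mono ennreal_leI R that) auto
    also have "\<dots> = dobrushin_norm S X f * ennreal R"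
      unfolding dobrushin_norm_eq by (rule nn_integral_multc) simp
    also have "\<dots> = ennreal C" unfolding C_def
      using f by (simp add: dobrushin_smooth_def ennreal_mult_less_top)
    finally show ?thesis by (simp add: ennreal_le_iff2 C_def) (smt (verit) enn2real_nonneg)
  qed
  show ?thesis
  proof (rule bounded_funsI)
    fix x assume "x \<in> topspace T"
    with le[OF this x0] le[OF x0 this] show "\<bar>f x\<bar> \<le> \<bar>f x0\<bar> + C" by linarith
  qed
qed (simp add: bounded_funs_def)

lemma integrable_bounded_borel:
  assumes \<mu>: "\<mu> \<in> borel_probs T" and f: "f \<in> borel_measurable (borel_of T)" "f \<in> bounded_funs (topspace T)"
  shows "integrable \<mu> f"
proof -
  interpret prob_space \<mu> using \<mu> by (simp add: borel_probs_def)
  have sets: "sets \<mu> = sets (borel_of T)" using \<mu> by (simp add: borel_probs_def)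
  obtain C where "\<forall>x\<in>topspace T. \<bar>f x\<bar> \<le> C" using f(2) by (auto simp: bounded_funs_def)
  then show ?thesis
    using f(1) sets sets_eq_imp_space_eq[OF sets]
    by (intro integrable_const_bound[of _ C]) (auto cong: measurable_cong_sets)
qed

text \<open>A joining turns the difference into one integral of f x - f y. Sum and integral are
  exchanged, and each integrated coordinate distance is at most the supremum: Hoelder's inequality
  for l1 and l-infinity over S.\<close>

lemma integral_difference_le:
  assumes m: "m \<in> joinings T \<mu> \<nu>" and \<mu>: "\<mu> \<in> borel_probs T" and \<nu>: "\<nu> \<in> borel_probs T"
    and f: "f \<in> dobrushin_smooth S X"
  shows "ennreal ((\<integral>x. f x \<partial>\<mu>) - (\<integral>x. f x \<partial>\<nu>)) \<le>
    dobrushin_norm S X f * (SUP s\<in>S. \<integral>\<^sup>+ (x, y). ennreal (coord_dist s x y) \<partial>m)"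
    (is "_ \<le> _ * ?\<sigma>")
proof -
  interpret m: prob_space m using m by (simp add: joinings_def borel_probs_def)
  have sets: "sets m = sets (borel_of (prod_topology T T))" using m by (simp add: joinings_def borel_probs_def)
  have sp: "space m = topspace T \<times> topspace T" using sets_eq_imp_space_eq[OF sets] by simp
  have fc: "continuous_map T euclideanreal f" using f by (simp add: dobrushin_smooth_def)
  have fm: "f \<in> borel_measurable (borel_of T)" by (rule continuous_map_borel_measurable[OF fc])
  have fst: "fst \<in> measurable m (borel_of T)" and snd: "snd \<in> measurable m (borel_of T)"
    using continuous_map_measurable_borel_of[OF continuous_map_fst, of T T]
      continuous_map_measurable_borel_of[OF continuous_map_snd, of T T] sets
    by (auto cong: measurable_cong_sets)
  have \<mu>_eq: "distr m (borel_of T) fst = \<mu>" and \<nu>_eq: "distr m (borel_of T) snd = \<nu>"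
    using m by (auto simp: joinings_def)
  note fi = integrable_bounded_borel[OF _ fm dobrushin_smooth_bounded[OF f]]
  have i1: "integrable m (\<lambda>z. f (fst z))"
    using fi[OF \<mu>] unfolding \<mu>_eq[symmetric] by (subst (asm) integrable_distr_eq[OF fst fm])
  have i2: "integrable m (\<lambda>z. f (snd z))"
    using fi[OF \<nu>] unfolding \<nu>_eq[symmetric] by (subst (asm) integrable_distr_eq[OF snd fm])
  have dm: "(\<lambda>z. ennreal (coord_dist s (fst z) (snd z))) \<in> borel_measurable m" if "s \<in> S" for s
    using continuous_map_borel_measurable[OF continuous_coord_dist[OF that]] sets
    by (auto cong: measurable_cong_sets)
  have "(\<integral>x. f x \<partial>\<mu>) = (\<integral>z. f (fst z) \<partial>m)" unfolding \<mu>_eq[symmetric] by (rule integral_distr[OF fst fm])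
  moreover have "(\<integral>x. f x \<partial>\<nu>) = (\<integral>z. f (snd z) \<partial>m)" unfolding \<nu>_eq[symmetric] by (rule integral_distr[OF snd fm])
  ultimately have "ennreal ((\<integral>x. f x \<partial>\<mu>) - (\<integral>x. f x \<partial>\<nu>)) = ennreal (\<integral>z. f (fst z) - f (snd z) \<partial>m)"
    using i1 i2 by simp
  also have "\<dots> \<le> (\<integral>\<^sup>+z. ennreal (f (fst z) - f (snd z)) \<partial>m)"
    by (intro ennreal_integral_le_nn_integral Bochner_Integration.integrable_diff i1 i2)
  also have "\<dots> \<le> (\<integral>\<^sup>+z. \<integral>\<^sup>+s. partial_lipschitz S X f s * ennreal (coord_dist s (fst z) (snd z)) \<partial>count_space S \<partial>m)"
    by (intro nn_integral_mono difference_le_sum_partial_lipschitz fc) (auto simp: sp)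
  also have "\<dots> = (\<integral>\<^sup>+s. \<integral>\<^sup>+z. partial_lipschitz S X f s * ennreal (coord_dist s (fst z) (snd z)) \<partial>m \<partial>count_space S)"
    by (intro nn_integral_count_space_nn_integral countable borel_measurable_times_ennreal dm) auto
  also have "\<dots> \<le> (\<integral>\<^sup>+s. partial_lipschitz S X f s * ?\<sigma> \<partial>count_space S)"
  proof (rule nn_integral_mono)
    fix s assume "s \<in> space (count_space S)"
    then have s: "s \<in> S" by simp
    have "(\<integral>\<^sup>+z. partial_lipschitz S X f s * ennreal (coord_dist s (fst z) (snd z)) \<partial>m) =
      partial_lipschitz S X f s * (\<integral>\<^sup>+z. ennreal (coord_dist s (fst z) (snd z)) \<partial>m)"
      by (rule nn_integral_cmult[OF dm[OF s]])
    also have "\<dots> \<le> partial_lipschitz S X f s * ?\<sigma>"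
      using s by (intro mult_left_mono SUP_upper2[of s]) (auto simp: case_prod_beta')
    finally show "(\<integral>\<^sup>+z. partial_lipschitz S X f s * ennreal (coord_dist s (fst z) (snd z)) \<partial>m) \<le>
      partial_lipschitz S X f s * ?\<sigma>" .
  qed
  also have "\<dots> = dobrushin_norm S X f * ?\<sigma>"
    unfolding dobrushin_norm_eq by (rule nn_integral_multc) simp
  finally show ?thesis .
qed

lemma dobrushin_dist_le_steif_dist:
  assumes \<mu>: "\<mu> \<in> borel_probs T" and \<nu>: "\<nu> \<in> borel_probs T"
  shows "dobrushin_dist S X \<mu> \<nu> \<le> steif_dist S X \<mu> \<nu>"
  unfolding steif_dist_def
proof (rule INF_greatest)
  fix m assume m: "m \<in> joinings T \<mu> \<nu>"
  let ?\<sigma> = "SUP s\<in>S. \<integral>\<^sup>+ (x, y). ennreal (coord_dist s x y) \<partial>m"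
  show "dobrushin_dist S X \<mu> \<nu> \<le> ?\<sigma>"
    unfolding dobrushin_dist_def
  proof (rule SUP_least)
    fix f assume "f \<in> dobrushin_smooth S X - constants S X"
    then have f: "f \<in> dobrushin_smooth S X" by simp
    note le = integral_difference_le[OF m \<mu> \<nu> f]
    show "ennreal ((\<integral>x. f x \<partial>\<mu>) - (\<integral>x. f x \<partial>\<nu>)) / dobrushin_norm S X f \<le> ?\<sigma>"
    \<comment> \<open>With norm 0 the bound \<open>le\<close> makes the numerator 0, and 0 / 0 = 0
      in \<open>ennreal\<close>.\<close>
    proof (cases "dobrushin_norm S X f = 0")
      case True
      then show ?thesis using le by simp
    next
      case False
      then show ?thesis using le by (intro divide_le_posI_ennreal) (auto simp: zero_less_iff_neq_zero)
    qed
  qed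
qed

subsection \<open>The Steif distance is at most the Dobrushin distance\<close>

text \<open>For points that differ only at s, all terms of the cost but the one at s vanish, so the
  weight of a metric becomes a bound on the partial Lipschitz constant.\<close>

lemma Lipschitz_imp_dobrushin_norm_le:
  assumes F: "finite F" "F \<subseteq> S" and w: "\<And>s. s \<in> F \<Longrightarrow> 0 \<le> w s"
    and f: "\<And>x y. x \<in> topspace T \<Longrightarrow> y \<in> topspace T \<Longrightarrow> f x - f y \<le> (\<Sum>s\<in>F. w s * coord_dist s x y)"
  shows "dobrushin_norm S X f \<le> ennreal (\<Sum>s\<in>F. w s)"
proof -
  have "partial_lipschitz S X f s \<le> (if s \<in> F then ennreal (w s) else 0)" if s: "s \<in> S" for s
    unfolding partial_lipschitz_def
  proof (rule SUP_least, clarify)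
    fix x y assume x: "x \<in> topspace T" and y: "y \<in> topspace T" and ne: "x \<noteq> y"
      and agree: "\<forall>t\<in>S - {s}. x t = y t"
    have d: "coord_dist s x y > 0" by (rule coord_dist_pos[OF s x y ne]) (use agree in blast)
    have "(\<Sum>t\<in>F. w t * coord_dist t x y) = (\<Sum>t\<in>F. if t = s then w s * coord_dist s x y else 0)"
    proof (rule sum.cong[OF refl])
      fix t assume t: "t \<in> F"
      then have "x t \<in> mspace (X t)" "t \<in> S" using x F by (auto simp: topspace_T)
      then show "w t * coord_dist t x y = (if t = s then w s * coord_dist s x y else 0)"
        using agree by auto
    qed
    also have "\<dots> = (if s \<in> F then w s * coord_dist s x y else 0)" using F(1) by (subst sum.delta) auto
    finally have "f x - f y \<le> (if s \<in> F then w s * coord_dist s x y else 0)" using f[OF x y] by simp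
    then have "(f x - f y) / coord_dist s x y \<le> (if s \<in> F then w s else 0)"
      using d by (auto simp: field_simps split: if_splits)
    then have "ennreal ((f x - f y) / coord_dist s x y) \<le> ennreal (if s \<in> F then w s else 0)" by (rule ennreal_leI)
    then show "ennreal ((f x - f y) / coord_dist s x y) \<le> (if s \<in> F then ennreal (w s) else 0)"
      by (simp only: if_distrib[of ennreal] ennreal_0)
  qed
  then have "dobrushin_norm S X f \<le> (\<integral>\<^sup>+s. (if s \<in> F then ennreal (w s) else 0) \<partial>count_space S)"
    unfolding dobrushin_norm_eq by (intro nn_integral_mono) simp
  also have "\<dots> = (\<Sum>s\<in>F. ennreal (w s))"
    by (subst nn_integral_count_space'[of F]) (use F in \<open>auto intro!: sum.cong\<close>)
  also have "\<dots> = ennreal (\<Sum>s\<in>F. w s)" using w by simp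
  finally show ?thesis .
qed

lemma continuous_weighted_coord_dist:
  assumes "finite F" "F \<subseteq> S"
  shows "continuous_map (prod_topology T T) euclideanreal (\<lambda>z. \<Sum>s\<in>F. w s * coord_dist s (fst z) (snd z))"
  using assms by (intro continuous_map_sum continuous_map_real_mult_left continuous_coord_dist) auto

text \<open>The finite sum is continuous in y and vanishes at y = x. This makes the inf-convolution,
  an infimum over uncountably many points in general, Borel measurable and admissible for the
  Dobrushin distance.\<close>

lemma Lipschitz_imp_continuous:
  assumes F: "finite F" "F \<subseteq> S"
    and f: "\<And>x y. x \<in> topspace T \<Longrightarrow> y \<in> topspace T \<Longrightarrow> f x - f y \<le> (\<Sum>s\<in>F. w s * coord_dist s x y)"
  shows "continuous_map T euclideanreal f"
  unfolding continuous_map_real_iff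
proof (intro ballI allI impI)
  fix x and e :: real assume x: "x \<in> topspace T" and e: "e > 0"
  let ?c = "\<lambda>y. \<Sum>s\<in>F. w s * coord_dist s x y"
  let ?U = "{y \<in> topspace T. ?c y \<in> {..<e}}"
  have "continuous_map T (prod_topology T T) (\<lambda>y. (x, y))"
    using x by (intro continuous_map_pairedI) auto
  from continuous_map_compose[OF this continuous_weighted_coord_dist[OF F, of w]]
  have "continuous_map T euclideanreal ?c" by (simp add: o_def)
  then have "openin T ?U" by (rule openin_continuous_map_preimage) simp
  moreover have "coord_dist s x x = 0" if "s \<in> F" for s
  proof -
    have "x s \<in> mspace (X s)" using x F that by (auto simp: topspace_T)
    then show ?thesis by simp
  qed
  then have "x \<in> ?U" using x e by simp
  moreover have "\<bar>f x - f y\<bar> < e" if "y \<in> ?U" for y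
    using f[of x y] f[of y x] x that by (auto simp: mdist_commute)
  ultimately show "\<exists>U. openin T U \<and> x \<in> U \<and> (\<forall>y\<in>U. \<bar>f x - f y\<bar> < e)" by blast
qed

text \<open>Turns the supremum of quotients into an inequality without division. Constants, over
  which the supremum does not range, have equal integrals under two probabilities.\<close>

lemma dobrushin_dist_bound:
  assumes D: "dobrushin_dist S X \<mu> \<nu> = ennreal D" "0 \<le> D"
    and \<mu>: "\<mu> \<in> borel_probs T" and \<nu>: "\<nu> \<in> borel_probs T"
    and F: "finite F" "F \<subseteq> S" and w: "\<And>s. s \<in> F \<Longrightarrow> 0 \<le> w s"
    and f: "\<And>x y. x \<in> topspace T \<Longrightarrow> y \<in> topspace T \<Longrightarrow> f x - f y \<le> (\<Sum>s\<in>F. w s * coord_dist s x y)"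
  shows "(\<integral>x. f x \<partial>\<mu>) - (\<integral>x. f x \<partial>\<nu>) \<le> D * (\<Sum>s\<in>F. w s)"
proof (cases "f \<in> constants S X")
  case True
  interpret \<mu>: prob_space \<mu> using \<mu> by (simp add: borel_probs_def)
  interpret \<nu>: prob_space \<nu> using \<nu> by (simp add: borel_probs_def)
  obtain c where c: "\<And>x. x \<in> topspace T \<Longrightarrow> f x = c" using True by (auto simp: constants_def constant_on_def)
  have "space \<mu> = topspace T" "space \<nu> = topspace T"
    using \<mu> \<nu> sets_eq_imp_space_eq[of _ "borel_of T"] by (auto simp: borel_probs_def)
  then have "(\<integral>x. f x \<partial>\<mu>) = (\<integral>x. c \<partial>\<mu>)" "(\<integral>x. f x \<partial>\<nu>) = (\<integral>x. c \<partial>\<nu>)"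
    by (intro Bochner_Integration.integral_cong; simp add: c)+
  then show ?thesis using D(2) w by (simp add: \<mu>.prob_space \<nu>.prob_space sum_nonneg)
next
  case False
  have n: "dobrushin_norm S X f \<le> ennreal (\<Sum>s\<in>F. w s)"
    by (rule Lipschitz_imp_dobrushin_norm_le[OF F w f])
  have W: "0 \<le> (\<Sum>s\<in>F. w s)" using w by (rule sum_nonneg)
  have fin: "dobrushin_norm S X f < \<infinity>" using n by (rule le_less_trans) simp
  have "continuous_map T euclideanreal f" by (rule Lipschitz_imp_continuous[OF F]) (rule f)
  with fin False have "f \<in> dobrushin_smooth S X - constants S X"
    unfolding dobrushin_smooth_def by blast
  then have le: "ennreal ((\<integral>x. f x \<partial>\<mu>) - (\<integral>x. f x \<partial>\<nu>)) / dobrushin_norm S X f \<le> ennreal D"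
    unfolding D(1)[symmetric] dobrushin_dist_def by (rule SUP_upper)
  have "ennreal ((\<integral>x. f x \<partial>\<mu>) - (\<integral>x. f x \<partial>\<nu>)) \<le> ennreal D * dobrushin_norm S X f"
  proof (cases "dobrushin_norm S X f = 0")
    case True
    \<comment> \<open>A positive number divided by 0 is \<infinity> in \<open>ennreal\<close>, so
      the finite bound D forces the numerator to be 0.\<close>
    then show ?thesis using le by (auto simp: top_unique split: if_splits)
  next
    case False
    have "ennreal ((\<integral>x. f x \<partial>\<mu>) - (\<integral>x. f x \<partial>\<nu>)) =
      ennreal ((\<integral>x. f x \<partial>\<mu>) - (\<integral>x. f x \<partial>\<nu>)) / dobrushin_norm S X f * dobrushin_norm S X f"
      using False fin by (simp add: ennreal_divide_times)
    also have "\<dots> \<le> ennreal D * dobrushin_norm S X f" using le by (rule mult_right_mono) simp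
    finally show ?thesis .
  qed
  also have "\<dots> \<le> ennreal D * ennreal (\<Sum>s\<in>F. w s)" using n by (rule mult_left_mono) simp
  also have "\<dots> = ennreal (D * (\<Sum>s\<in>F. w s))" using D(2) W by (simp add: ennreal_mult)
  finally show ?thesis using D(2) W by (subst (asm) ennreal_le_iff) auto
qed

text \<open>The Kantorovich-Rubinstein step: an inf-convolution of \<open>v\<close> with the cost is a Lipschitz
  function between \<open>- u\<close> and \<open>v\<close>.\<close>
lemma dual_feasibility:
  assumes D: "dobrushin_dist S X \<mu> \<nu> = ennreal D" "0 \<le> D"
    and \<mu>: "\<mu> \<in> borel_probs T" and \<nu>: "\<nu> \<in> borel_probs T"
    and F: "finite F" "F \<subseteq> S" and w: "\<And>s. s \<in> F \<Longrightarrow> 0 \<le> w s"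
    and u: "u \<in> borel_measurable (borel_of T)" "u \<in> bounded_funs (topspace T)"
    and v: "v \<in> borel_measurable (borel_of T)" "v \<in> bounded_funs (topspace T)"
    and uv: "\<And>x y. x \<in> topspace T \<Longrightarrow> y \<in> topspace T \<Longrightarrow>
      0 \<le> u x + v y + (\<Sum>s\<in>F. w s * coord_dist s x y)"
  shows "0 \<le> (\<integral>x. u x \<partial>\<mu>) + (\<integral>x. v x \<partial>\<nu>) + D * (\<Sum>s\<in>F. w s)"
proof -
  define c where "c x y = (\<Sum>s\<in>F. w s * coord_dist s x y)" for x y
  have pt: "x s \<in> mspace (X s)" if "s \<in> F" "x \<in> topspace T" for s x
    using that F by (auto simp: topspace_T)
  obtain f where f: "\<And>x. x \<in> topspace T \<Longrightarrow> f x \<le> v x" "\<And>x. x \<in> topspace T \<Longrightarrow> - u x \<le> f x"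
    "\<And>x y. x \<in> topspace T \<Longrightarrow> y \<in> topspace T \<Longrightarrow> f x - f y \<le> c x y" "f \<in> bounded_funs (topspace T)"
  proof (rule inf_convolution[of "topspace T" c v u])
    show "c x x = 0" if "x \<in> topspace T" for x
      unfolding c_def using pt[OF _ that] by (intro sum.neutral) auto
    show "0 \<le> c x y" for x y unfolding c_def using w by (intro sum_nonneg mult_nonneg_nonneg) auto
    show "c x z \<le> c x y + c y z" if "x \<in> topspace T" "y \<in> topspace T" "z \<in> topspace T" for x y z
      unfolding c_def sum.distrib[symmetric] distrib_left[symmetric]
      using pt that w by (intro sum_mono mult_left_mono mdist_triangle) auto
  qed (use v(2) uv in \<open>auto simp: c_def\<close>)
  have fm: "f \<in> borel_measurable (borel_of T)"
    by (intro continuous_map_borel_measurable Lipschitz_imp_continuous[OF F]) (use f(3) in \<open>auto simp: c_def\<close>)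
  have sp: "space \<mu> = topspace T" "space \<nu> = topspace T"
    using \<mu> \<nu> sets_eq_imp_space_eq[of _ "borel_of T"] by (auto simp: borel_probs_def)
  \<comment> \<open>From u \<ge> -f and v \<ge> f: \<mu>(u) + \<nu>(v) \<ge> -(\<mu>(f) - \<nu>(f))
    \<ge> -D \<Sum> w_s.\<close>
  have "(\<integral>x. - u x \<partial>\<mu>) \<le> (\<integral>x. f x \<partial>\<mu>)"
    by (intro integral_mono integrable_minus integrable_bounded_borel \<mu> u fm f(4)) (use f(2) sp in auto)
  moreover have "(\<integral>x. f x \<partial>\<nu>) \<le> (\<integral>x. v x \<partial>\<nu>)"
    by (intro integral_mono integrable_bounded_borel \<nu> v fm f(4)) (use f(1) sp in auto)
  moreover have "(\<integral>x. f x \<partial>\<mu>) - (\<integral>x. f x \<partial>\<nu>) \<le> D * (\<Sum>s\<in>F. w s)"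
    by (rule dobrushin_dist_bound[OF D \<mu> \<nu> F w]) (use f(3) in \<open>auto simp: c_def\<close>)
  ultimately show ?thesis by simp
qed

text \<open>P is the cone of demands. The functions u and v may have either sign, which forces
  equality for the marginals; the weights are nonnegative, which leaves an upper bound for d_s.
  Taking u and v Borel instead of continuous makes the marginals exact on indicators of Borel
  sets.\<close>

lemma finitely_additive_joining:
  assumes D: "dobrushin_dist S X \<mu> \<nu> = ennreal D" "0 \<le> D"
    and \<mu>: "\<mu> \<in> borel_probs T" and \<nu>: "\<nu> \<in> borel_probs T"
  obtains L where "positive_functional (topspace T \<times> topspace T) L"
    "\<And>u v. u \<in> borel_measurable (borel_of T) \<Longrightarrow> u \<in> bounded_funs (topspace T) \<Longrightarrow>
      v \<in> borel_measurable (borel_of T) \<Longrightarrow> v \<in> bounded_funs (topspace T) \<Longrightarrow>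
      L (\<lambda>z. u (fst z) + v (snd z)) = (\<integral>x. u x \<partial>\<mu>) + (\<integral>x. v x \<partial>\<nu>)"
    "\<And>s. s \<in> S \<Longrightarrow> L (\<lambda>z. coord_dist s (fst z) (snd z)) \<le> D"
proof -
  interpret \<mu>: prob_space \<mu> using \<mu> by (simp add: borel_probs_def)
  interpret \<nu>: prob_space \<nu> using \<nu> by (simp add: borel_probs_def)
  let ?\<Omega> = "topspace T \<times> topspace T"
  define B where "B = borel_measurable (borel_of T) \<inter> bounded_funs (topspace T)"
  have B_add: "(\<lambda>x. u x + v x) \<in> B" if "u \<in> B" "v \<in> B" for u v
    using that by (auto simp: B_def bounded_funs_add)
  have B_scale: "(\<lambda>x. t * u x) \<in> B" if "u \<in> B" for u and t :: real
    using that by (auto simp: B_def bounded_funs_scale)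
  have B_const: "(\<lambda>x. t) \<in> B" for t :: real by (auto simp: B_def bounded_funs_def)
  have B_int: "integrable \<mu> u" "integrable \<nu> u" if "u \<in> B" for u
    using that by (auto simp: B_def intro: integrable_bounded_borel[OF \<mu>] integrable_bounded_borel[OF \<nu>])
  have B_bd: "(\<lambda>z. u (fst z)) \<in> bounded_funs ?\<Omega>" "(\<lambda>z. u (snd z)) \<in> bounded_funs ?\<Omega>" if "u \<in> B" for u
    using that by (auto simp: B_def bounded_funs_def)
  define P where "P = {(h, r). \<exists>u v F w. u \<in> B \<and> v \<in> B \<and> finite F \<and> F \<subseteq> S \<and> (\<forall>s\<in>F. 0 \<le> w s) \<and>
     h = (\<lambda>z. u (fst z) + v (snd z) + (\<Sum>s\<in>F. w s * coord_dist s (fst z) (snd z))) \<and>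
     r = (\<integral>x. u x \<partial>\<mu>) + (\<integral>x. v x \<partial>\<nu>) + D * (\<Sum>s\<in>F. w s)}"
  have PI: "(\<lambda>z. u (fst z) + v (snd z) + (\<Sum>s\<in>F. w s * coord_dist s (fst z) (snd z)),
     (\<integral>x. u x \<partial>\<mu>) + (\<integral>x. v x \<partial>\<nu>) + D * (\<Sum>s\<in>F. w s)) \<in> P"
    if "u \<in> B" "v \<in> B" "finite F" "F \<subseteq> S" "\<forall>s\<in>F. 0 \<le> w s" for u v F w
    unfolding P_def using that by blast
  have PE: "\<exists>u v F w. u \<in> B \<and> v \<in> B \<and> finite F \<and> F \<subseteq> S \<and> (\<forall>s\<in>F. 0 \<le> w s) \<and>
     h = (\<lambda>z. u (fst z) + v (snd z) + (\<Sum>s\<in>F. w s * coord_dist s (fst z) (snd z))) \<and>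
     r = (\<integral>x. u x \<partial>\<mu>) + (\<integral>x. v x \<partial>\<nu>) + D * (\<Sum>s\<in>F. w s)" if "(h, r) \<in> P" for h r
    using that unfolding P_def by blast
  obtain L where L: "linear_on_funs (bounded_funs ?\<Omega>) L"
    "\<And>f. f \<in> bounded_funs ?\<Omega> \<Longrightarrow> (\<And>z. z \<in> ?\<Omega> \<Longrightarrow> 0 \<le> f z) \<Longrightarrow> 0 \<le> L f"
    "\<And>h r. (h, r) \<in> P \<Longrightarrow> h \<in> bounded_funs ?\<Omega> \<Longrightarrow> L h \<le> r"
  proof (rule positive_functional_exists[of P ?\<Omega>])
    fix h r h' r' assume "(h, r) \<in> P" "(h', r') \<in> P"
    then obtain u v F w u' v' F' w' where
      1: "u \<in> B" "v \<in> B" "finite F" "F \<subseteq> S" "\<forall>s\<in>F. 0 \<le> w s"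
      "h = (\<lambda>z. u (fst z) + v (snd z) + (\<Sum>s\<in>F. w s * coord_dist s (fst z) (snd z)))"
      "r = (\<integral>x. u x \<partial>\<mu>) + (\<integral>x. v x \<partial>\<nu>) + D * (\<Sum>s\<in>F. w s)" and
      2: "u' \<in> B" "v' \<in> B" "finite F'" "F' \<subseteq> S" "\<forall>s\<in>F'. 0 \<le> w' s"
      "h' = (\<lambda>z. u' (fst z) + v' (snd z) + (\<Sum>s\<in>F'. w' s * coord_dist s (fst z) (snd z)))"
      "r' = (\<integral>x. u' x \<partial>\<mu>) + (\<integral>x. v' x \<partial>\<nu>) + D * (\<Sum>s\<in>F'. w' s)"
      using PE[of h r] PE[of h' r'] by blast
    \<comment> \<open>Weights are extended by 0 to F \<union> F' and added, so that two demands with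
      different finite index sets add up to one.\<close>
    define W where "W s = (if s \<in> F then w s else 0) + (if s \<in> F' then w' s else 0)" for s
    have split: "(\<Sum>s\<in>F \<union> F'. W s * a s) = (\<Sum>s\<in>F. w s * a s) + (\<Sum>s\<in>F'. w' s * a s)" for a :: "'i \<Rightarrow> real"
    proof -
      have "(\<Sum>s\<in>F \<union> F'. W s * a s) =
          (\<Sum>s\<in>F \<union> F'. if s \<in> F then w s * a s else 0) + (\<Sum>s\<in>F \<union> F'. if s \<in> F' then w' s * a s else 0)"
        unfolding sum.distrib[symmetric] by (rule sum.cong) (auto simp: W_def algebra_simps)
      also have "(\<Sum>s\<in>F \<union> F'. if s \<in> F then w s * a s else 0) = (\<Sum>s\<in>F. w s * a s)"
        by (rule sum.mono_neutral_cong_right) (use 1(3) 2(3) in auto)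
      also have "(\<Sum>s\<in>F \<union> F'. if s \<in> F' then w' s * a s else 0) = (\<Sum>s\<in>F'. w' s * a s)"
        by (rule sum.mono_neutral_cong_right) (use 1(3) 2(3) in auto)
      finally show ?thesis .
    qed
    have "(\<lambda>z. (u (fst z) + u' (fst z)) + (v (snd z) + v' (snd z)) + (\<Sum>s\<in>F \<union> F'. W s * coord_dist s (fst z) (snd z)),
      (\<integral>x. u x + u' x \<partial>\<mu>) + (\<integral>x. v x + v' x \<partial>\<nu>) + D * (\<Sum>s\<in>F \<union> F'. W s)) \<in> P"
      by (rule PI[of "\<lambda>x. u x + u' x" "\<lambda>x. v x + v' x" "F \<union> F'" W])
         (use 1 2 in \<open>auto simp: W_def intro!: B_add\<close>)
    moreover have "(\<integral>x. u x + u' x \<partial>\<mu>) = (\<integral>x. u x \<partial>\<mu>) + (\<integral>x. u' x \<partial>\<mu>)"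
      "(\<integral>x. v x + v' x \<partial>\<nu>) = (\<integral>x. v x \<partial>\<nu>) + (\<integral>x. v' x \<partial>\<nu>)"
      using 1 2 by (simp_all add: B_int)
    moreover have "(\<Sum>s\<in>F \<union> F'. W s) = (\<Sum>s\<in>F. w s) + (\<Sum>s\<in>F'. w' s)" using split[of "\<lambda>_. 1"] by simp
    ultimately show "(\<lambda>z. h z + h' z, r + r') \<in> P"
      unfolding 1(6,7) 2(6,7) split by (simp add: algebra_simps)
  next
    fix h r and t :: real assume "(h, r) \<in> P" "t > 0"
    then obtain u v F w where
      1: "u \<in> B" "v \<in> B" "finite F" "F \<subseteq> S" "\<forall>s\<in>F. 0 \<le> w s"
      "h = (\<lambda>z. u (fst z) + v (snd z) + (\<Sum>s\<in>F. w s * coord_dist s (fst z) (snd z)))"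
      "r = (\<integral>x. u x \<partial>\<mu>) + (\<integral>x. v x \<partial>\<nu>) + D * (\<Sum>s\<in>F. w s)"
      using PE[of h r] by blast
    have "(\<lambda>z. t * u (fst z) + t * v (snd z) + (\<Sum>s\<in>F. (t * w s) * coord_dist s (fst z) (snd z)),
      (\<integral>x. t * u x \<partial>\<mu>) + (\<integral>x. t * v x \<partial>\<nu>) + D * (\<Sum>s\<in>F. t * w s)) \<in> P"
      by (rule PI[of "\<lambda>x. t * u x" "\<lambda>x. t * v x" F "\<lambda>s. t * w s"])
         (use 1 \<open>t > 0\<close> in \<open>auto intro!: B_scale\<close>)
    then show "(\<lambda>z. t * h z, t * r) \<in> P"
      unfolding 1(6,7) by (simp add: algebra_simps sum_distrib_left)
  next
    fix c :: real
    show "(\<lambda>z. c, c) \<in> P"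
      using PI[OF B_const B_const, of "{}" "\<lambda>_. 0" c 0] by (simp add: \<mu>.prob_space)
  next
    fix h r assume "(h, r) \<in> P" and nn: "\<And>z. z \<in> ?\<Omega> \<Longrightarrow> 0 \<le> h z"
    then obtain u v F w where
      1: "u \<in> B" "v \<in> B" "finite F" "F \<subseteq> S" "\<forall>s\<in>F. 0 \<le> w s"
      "h = (\<lambda>z. u (fst z) + v (snd z) + (\<Sum>s\<in>F. w s * coord_dist s (fst z) (snd z)))"
      "r = (\<integral>x. u x \<partial>\<mu>) + (\<integral>x. v x \<partial>\<nu>) + D * (\<Sum>s\<in>F. w s)"
      using PE[of h r] by blast
    show "0 \<le> r" unfolding 1(7)
    proof (rule dual_feasibility[OF D \<mu> \<nu> 1(3,4)])
      fix x y assume "x \<in> topspace T" "y \<in> topspace T"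
      then show "0 \<le> u x + v y + (\<Sum>s\<in>F. w s * coord_dist s x y)"
        using nn[of "(x, y)"] unfolding 1(6) by simp
    qed (use 1 in \<open>auto simp: B_def\<close>)
  qed blast
  interpret positive_functional ?\<Omega> L by unfold_locales (rule L(1), rule L(2))
  show ?thesis
  proof (rule that)
    show "positive_functional ?\<Omega> L" by (rule positive_functional_axioms)
  next
    fix u v assume "u \<in> borel_measurable (borel_of T)" "u \<in> bounded_funs (topspace T)"
      "v \<in> borel_measurable (borel_of T)" "v \<in> bounded_funs (topspace T)"
    then have uv: "u \<in> B" "v \<in> B" by (auto simp: B_def)
    have le: "L (\<lambda>z. u (fst z) + v (snd z)) \<le> (\<integral>x. u x \<partial>\<mu>) + (\<integral>x. v x \<partial>\<nu>)" if "u \<in> B" "v \<in> B" for u v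
      using L(3)[OF PI[OF that, of "{}" "\<lambda>_. 0"]] B_bd that by (simp add: bounded_funs_add)
    have bd: "(\<lambda>z. u (fst z) + v (snd z)) \<in> bounded_funs ?\<Omega>" using uv by (intro bounded_funs_add B_bd)
    \<comment> \<open>The upper bound applied to -u and -v is the reverse inequality.\<close>
    have "L (\<lambda>z. (-1) * u (fst z) + (-1) * v (snd z)) \<le> (\<integral>x. (-1) * u x \<partial>\<mu>) + (\<integral>x. (-1) * v x \<partial>\<nu>)"
      by (intro le B_scale uv)
    moreover have "L (\<lambda>z. (-1) * u (fst z) + (-1) * v (snd z)) = - L (\<lambda>z. u (fst z) + v (snd z))"
      using L_scale[OF bd, of "-1"] by (simp add: algebra_simps)
    ultimately show "L (\<lambda>z. u (fst z) + v (snd z)) = (\<integral>x. u x \<partial>\<mu>) + (\<integral>x. v x \<partial>\<nu>)"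
      using le[OF uv] by simp
  next
    fix s assume s: "s \<in> S"
    obtain R where R: "\<And>s x y. s \<in> S \<Longrightarrow> x \<in> topspace T \<Longrightarrow> y \<in> topspace T \<Longrightarrow> coord_dist s x y \<le> R"
      using coord_dist_bounded by blast
    have "(\<lambda>z. coord_dist s (fst z) (snd z)) \<in> bounded_funs ?\<Omega>"
      by (rule bounded_funsI[of _ _ R]) (use R[OF s] in auto)
    then show "L (\<lambda>z. coord_dist s (fst z) (snd z)) \<le> D"
      using L(3)[OF PI[OF B_const B_const, of "{s}" "\<lambda>_. 1" 0 0]] s by simp
  qed
qed

text \<open>One joining M serves all coordinates: on open sets it is at most the content m of L, so
  \<open>integral_le_L\<close> carries the bound D for every d_s from L to M. An infinite Dobrushin
  distance is trivial.\<close>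

lemma steif_dist_le_dobrushin_dist:
  assumes \<mu>: "\<mu> \<in> borel_probs T" and \<nu>: "\<nu> \<in> borel_probs T"
  shows "steif_dist S X \<mu> \<nu> \<le> dobrushin_dist S X \<mu> \<nu>"
proof (cases "dobrushin_dist S X \<mu> \<nu> = \<infinity>")
  case False
  let ?\<Omega> = "topspace T \<times> topspace T"
  obtain D where D: "dobrushin_dist S X \<mu> \<nu> = ennreal D" "0 \<le> D"
    using False by (cases "dobrushin_dist S X \<mu> \<nu>") auto
  obtain L where "positive_functional ?\<Omega> L"
    and L_marginals: "\<And>u v. u \<in> borel_measurable (borel_of T) \<Longrightarrow> u \<in> bounded_funs (topspace T) \<Longrightarrow>
      v \<in> borel_measurable (borel_of T) \<Longrightarrow> v \<in> bounded_funs (topspace T) \<Longrightarrow>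
      L (\<lambda>z. u (fst z) + v (snd z)) = (\<integral>x. u x \<partial>\<mu>) + (\<integral>x. v x \<partial>\<nu>)"
    and L_D: "\<And>s. s \<in> S \<Longrightarrow> L (\<lambda>z. coord_dist s (fst z) (snd z)) \<le> D"
    using finitely_additive_joining[OF D \<mu> \<nu>] by blast
  then interpret positive_functional ?\<Omega> L by simp
  define m where "m E = L (indicator E)" for E :: "(('i \<Rightarrow> 'a) \<times> ('i \<Rightarrow> 'a)) set"
  have ind: "(indicator A :: _ \<Rightarrow> real) \<in> borel_measurable (borel_of T)"
      "(indicator A :: _ \<Rightarrow> real) \<in> bounded_funs (topspace T)" if "A \<in> sets (borel_of T)" for A
    using that by (auto intro!: bounded_funsI[of _ _ 1] simp: indicator_def)
  have zero: "(\<lambda>x. 0::real) \<in> borel_measurable (borel_of T)" "(\<lambda>x. 0) \<in> bounded_funs (topspace T)"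
    by (auto simp: bounded_funs_def)
  obtain M where M: "M \<in> joinings T \<mu> \<nu>" "\<And>W. openin (prod_topology T T) W \<Longrightarrow> measure M W \<le> m W"
  proof (rule joining_of_finitely_additive[OF completely_metrizable_T second_countable_T \<mu> \<nu>, of m])
    show "0 \<le> m E" for E unfolding m_def by (rule pos[OF indicator_bounded]) simp
    show "m (E \<union> F) = m E + m F" if "E \<inter> F = {}" for E F
    proof -
      have "indicator (E \<union> F) = (\<lambda>z. indicator E z + indicator F z :: real)"
        using that by (auto simp: indicator_def fun_eq_iff)
      then show ?thesis unfolding m_def by (simp add: L_add indicator_bounded)
    qed
    fix A assume A: "A \<in> sets (borel_of T)"
    have AT: "A \<subseteq> topspace T" using sets.sets_into_space[OF A] by simp
    have sets: "A \<in> sets \<mu>" "A \<in> sets \<nu>" using A \<mu> \<nu> by (auto simp: borel_probs_def)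
    have "m (A \<times> topspace T) = L (\<lambda>z. indicator A (fst z) + 0)"
      unfolding m_def by (rule L_cong[OF indicator_bounded]) (auto simp: indicator_def)
    also have "\<dots> = measure \<mu> A"
      using L_marginals[OF ind[OF A] zero] sets by (simp add: Int_absorb2 sets.sets_into_space)
    finally show "m (A \<times> topspace T) = measure \<mu> A" .
    have "m (topspace T \<times> A) = L (\<lambda>z. 0 + indicator A (snd z))"
      unfolding m_def by (rule L_cong[OF indicator_bounded]) (auto simp: indicator_def)
    also have "\<dots> = measure \<nu> A"
      using L_marginals[OF zero ind[OF A]] sets by (simp add: Int_absorb2 sets.sets_into_space)
    finally show "m (topspace T \<times> A) = measure \<nu> A" .
  qed blast
  have pM: "prob_space M" and sM: "sets M = sets (borel_of (prod_topology T T))"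
    using M(1) by (auto simp: joinings_def borel_probs_def)
  interpret M: prob_space M by (rule pM)
  have spM: "space M = ?\<Omega>" using sets_eq_imp_space_eq[OF sM] by simp
  obtain R where R: "\<And>s x y. s \<in> S \<Longrightarrow> x \<in> topspace T \<Longrightarrow> y \<in> topspace T \<Longrightarrow> coord_dist s x y \<le> R"
    using coord_dist_bounded by blast
  have "(\<integral>\<^sup>+ (x, y). ennreal (coord_dist s x y) \<partial>M) \<le> ennreal D" if s: "s \<in> S" for s
  proof -
    let ?d = "\<lambda>z. coord_dist s (fst z) (snd z)"
    have meas: "?d \<in> borel_measurable M"
      using continuous_map_borel_measurable[OF continuous_coord_dist[OF s]] sM
      by (auto cong: measurable_cong_sets)
    then have int: "integrable M ?d"
      by (intro M.integrable_const_bound[of _ R]) (use R[OF s] spM in auto)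
    have "(\<integral>z. ?d z \<partial>M) \<le> L ?d"
      by (rule integral_le_L[OF pM sM _ _ continuous_coord_dist[OF s], of R])
         (use M(2) R[OF s] in \<open>auto simp: m_def\<close>)
    also have "\<dots> \<le> D" by (rule L_D[OF s])
    finally have "ennreal (\<integral>z. ?d z \<partial>M) \<le> ennreal D" by (rule ennreal_leI)
    then show ?thesis
      by (simp add: case_prod_beta' nn_integral_eq_integral[OF int])
  qed
  then have "(SUP s\<in>S. \<integral>\<^sup>+ (x, y). ennreal (coord_dist s x y) \<partial>M) \<le> ennreal D" by (rule SUP_least)
  then show ?thesis
    unfolding steif_dist_def D(1) by (rule INF_lower2[OF M(1)])
qed simp

end

theorem mainTheorem1:
  fixes S :: "'i set" and X :: "'i \<Rightarrow> 'a metric"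
    and \<mu> \<nu> :: "('i \<Rightarrow> 'a) measure"
  assumes "countable S"
    and "\<And>s. s \<in> S \<Longrightarrow> mcomplete_of (X s)"
    and "\<And>s. s \<in> S \<Longrightarrow> separable_space (mtopology_of (X s))"
    and "(SUP s\<in>S. metric_diam (X s)) < \<infinity>"
    and "\<mu> \<in> borel_probs (prod_space S X)"
    and "\<nu> \<in> borel_probs (prod_space S X)"
  shows "dobrushin_dist S X \<mu> \<nu> = steif_dist S X \<mu> \<nu>"
proof -
  interpret bounded_polish_family S X
    using assms(1-4) by unfold_locales
  show ?thesis
    using assms(5,6) by (intro antisym dobrushin_dist_le_steif_dist steif_dist_le_dobrushin_dist)
qed

end
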